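(* Let $G$ be a graph with orientation $\mathfrak o$, $t\ge2$, $H$ a subgroup of $\operatorname{Aut}(G)$, $\mathbf F\subseteq\mathbf E_{\mathfrak o}(G)$ and $\alpha\in M_t(\mathbf F)$. Then for every length $l$ (with $\gamma$ denoting any representative of the class $[\gamma]$), $$N_{t,\mathbf F}(\alpha,l)=\frac{1}{t^{|\mathbf F|}}\sum_{[\gamma]\in M_t(\mathbf F)/H}\Big(\sum_{\gamma'\in[\gamma]}\epsilon_t^{-\langle\gamma',\alpha\rangle}\Big)\operatorname{trace}\left(W_{1,\gamma}^l\right),\quad \widetilde N_{t,\mathbf F}(\alpha,l)=\frac{1}{t^{|\mathbf F|}}\sum_{[\gamma]\in M_t(\mathbf F)/H}\Big(\sum_{\gamma'\in[\gamma]}\epsilon_t^{-\langle\gamma',\alpha\rangle}\Big)\operatorname{trace}\left(A_{\gamma}^l\right).$$ If moreover $G$ has genus $g$, then for every spanning tree $T$ of $G$, every $\alpha\in H_1(G,\mathbb Z/t\mathbb Z)$ and every length $l$, $$N_t(\alpha,l)=\frac{1}{t^g}\sum_{[\gamma]\in M_t(\mathbf E_{\mathfrak o}^c(T))/H}\Big(\sum_{\gamma'\in[\gamma]}\epsilon_t^{-\langle\gamma',\alpha\rangle}\Big)\operatorname{trace}\left(W_{1,\gamma}^l\right),\quad \widetilde N_t(\alpha,l)=\frac{1}{t^g}\sum_{[\gamma]\in M_t(\mathbf E_{\mathfrak o}^c(T))/H}\Big(\sum_{\gamma'\in[\gamma]}\epsilon_t^{-\langle\gamma',\alpha\rangle}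\Big)\operatorname{trace}\left(A_{\gamma}^l\right).$$
   Context: A graph is connected and finite, loops and multiple edges allowed, vertices $v_1,\dots,v_n$, edges $e_1,\dots,e_m$, genus $g=m-n+1$. Each edge gives two mutually inverse oriented edges; $\mathbf e(0),\mathbf e(1)$ are initial/terminal vertices. $\mathfrak o$ picks a positively oriented $\mathbf e_k$ for each $e_k$; $\mathbf E_{\mathfrak o}(G)=\{\mathbf e_1,\dots,\mathbf e_m\}$; $\mathbf E(G)$ is all $2m$ oriented edges; $\mathbf E^c_{\mathfrak o}(T)$ the positively oriented edges not in $T$. A closed walk of length $l$ is $\mathbf a_1\cdots\mathbf a_l$ with $\mathbf a_{i+1}(0)=\mathbf a_i(1)$, $\mathbf a_l(1)=\mathbf a_1(0)$; a circuit is a closed walk with no backtrack ($\mathbf a_{i+1}\ne\mathbf a_i^{-1}$) and no tail ($\mathbf a_l\ne\mathbf a_1^{-1}$), counted as sequences. $C_1(G,\mathbb Z/t\mathbb Z)$ is the free module on $\mathbf E_{\mathfrak o}(G)$ with $1\cdot\mathbf e^{-1}=-1\cdot\mathbf e$; $\langle\sum a_k\mathbf e_k,\sum b_k\mathbf e_k\rangle=\sum a_kb_k$; $H_1(G,\mathbb Z/t\mathbb Z)$ consists of $\sum a_k\mathbf e_k$ with $\sum_{\mathbf e_k(0)=v}a_k=\sum_{\mathbf e_k(1)=v}a_k$ for all vertices $v$. $M_t(\mathbf F)$ is the submodule supported on $\mathbf F$, $\beta|_{\mathbf F}$ the restriction. For a walk $C=\mathbf a_1\cdots\mathbf a_l$,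 $C^{ab}_{[t]}$ is the reduction mod $t$ of $\sum\mathbf a_i$. $N_{t,\mathbf F}(\alpha,l)$ (resp. $\widetilde N_{t,\mathbf F}(\alpha,l)$) counts circuits (resp. closed walks) $C$ of length $l$ with $C^{ab}_{[t]}|_{\mathbf F}=\alpha$; $N_t=N_{t,\mathbf E_{\mathfrak o}(G)}$, $\widetilde N_t=\widetilde N_{t,\mathbf E_{\mathfrak o}(G)}$. $\epsilon_t=\exp(2\pi i/t)$; $\chi_\gamma(\mathbf e)=\epsilon_t^{\langle\gamma,1\cdot\mathbf e\rangle}$. $A_\gamma$: $n\times n$ with $(i,j)$ entry $\sum\chi_\gamma(\mathbf e)$ over $\mathbf e\in\mathbf E(G)$ from $v_i$ to $v_j$. $\mathbf e$ feeds into $\mathbf e'$ if $\mathbf e'\ne\mathbf e^{-1}$ and $\mathbf e(1)=\mathbf e'(0)$; $W_{1,\gamma}$: $2m\times2m$ indexed by $\mathbf E(G)$ with $(\mathbf e,\mathbf e')$ entry $\chi_\gamma(\mathbf e)$ if $\mathbf e$ feeds into $\mathbf e'$, else $0$. An automorphism $\tau\in\operatorname{Aut}(G)$ consists of incidence-preserving permutations of vertices and edges; it acts on oriented edges by sending $\mathbf e$ to the orientation of $\tau(e)$ with initial vertex $\tau(\mathbf e(0))$, with $\tau(\mathbf e^{-1})=\tau(\mathbf e)^{-1}$, and on $C_1$ by $\tau(\sum c_k\mathbf e_k)=\sum c_k\tau(\mathbf e_k)$ (using $1\cdot\mathbf e^{-1}=-1\cdot\mathbf e$). For a subset $S\subseteq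 C_1(G,\mathbb Z/t\mathbb Z)$ and $\gamma\in S$, $[\gamma]=\{\tau(\gamma)\in S:\tau\in H\}$, and $S/H=\{[\gamma]:\gamma\in S\}$. *)

theory Defs
  imports
    "Graph_Theory.Digraph_Component"
    "Graph_Theory.Bidirected_Digraph"
    "Jordan_Normal_Form.Matrix"
    "HOL-Algebra.Group"
    Complex_Main
begin

section \<open>Graphs, orientations, automorphisms\<close>

text \<open>
  The arcs of the digraph are the oriented edges of the graph, and \<open>arev\<close> is the fixed point free
  involution \<open>e \<mapsto> e\<inverse>\<close> (the locale \<open>bidirected_digraph\<close> lets it be the identity off the arcs).
  Loops and parallel edges are allowed; a loop gives two arcs. For such digraphs the library's
  \<open>connected\<close> is connectedness of the undirected graph, and it excludes the empty graph.
\<close>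
locale multigraph = bidirected_digraph G arev + fin_digraph G
  for G :: "('v, 'e) pre_digraph" and arev :: "'e \<Rightarrow> 'e" +
  assumes connected: "Digraph_Component.connected G"

definition orientation :: "('v, 'e) pre_digraph \<Rightarrow> ('e \<Rightarrow> 'e) \<Rightarrow> 'e set \<Rightarrow> bool" where
  "orientation G arev Eo \<longleftrightarrow> Eo \<subseteq> arcs G \<and> (\<forall>e \<in> arcs G. (e \<in> Eo) \<noteq> (arev e \<in> Eo))"

definition edge_of :: "('e \<Rightarrow> 'e) \<Rightarrow> 'e \<Rightarrow> 'e set" where
  "edge_of arev e = {e, arev e}"

definition edges :: "('v, 'e) pre_digraph \<Rightarrow> ('e \<Rightarrow> 'e) \<Rightarrow> 'e set set" where
  "edges G arev = edge_of arev ` arcs G"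

text \<open>The tails of the two orientations of an edge are its end vertices.\<close>
definition ends :: "('v, 'e) pre_digraph \<Rightarrow> 'e set \<Rightarrow> 'v set" where
  "ends G x = tail G ` x"

definition genus :: "('v, 'e) pre_digraph \<Rightarrow> ('e \<Rightarrow> 'e) \<Rightarrow> int" where
  "genus G arev = int (card (edges G arev)) - int (card (verts G)) + 1"

text \<open>
  An automorphism consists of incidence-preserving permutations of vertices and edges. The third
  component is its action on oriented edges. It is determined by the first two except on loops,
  where both orientations of the image have the required initial vertex; keeping it as part of the
  data leaves that choice free, while composition still gives a group acting on the oriented edges.
\<close>
record ('v, 'e) graph_aut =
  on_verts :: "'v \<Rightarrow> 'v"
  on_edges :: "'e set \<Rightarrow> 'e set"
  on_arcs :: "'e \<Rightarrow> 'e"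

definition is_aut :: "('v, 'e) pre_digraph \<Rightarrow> ('e \<Rightarrow> 'e) \<Rightarrow> ('v, 'e) graph_aut \<Rightarrow> bool" where
  "is_aut G arev \<tau> \<longleftrightarrow>
     on_verts \<tau> permutes verts G \<and>
     on_edges \<tau> permutes edges G arev \<and>
     (\<forall>x \<in> edges G arev. ends G (on_edges \<tau> x) = on_verts \<tau> ` ends G x) \<and>
     on_arcs \<tau> permutes arcs G \<and>
     (\<forall>e \<in> arcs G. on_arcs \<tau> e \<in> on_edges \<tau> (edge_of arev e) \<and>
                    tail G (on_arcs \<tau> e) = on_verts \<tau> (tail G e) \<and>
                    on_arcs \<tau> (arev e) = arev (on_arcs \<tau> e))"

definition Aut :: "('v, 'e) pre_digraph \<Rightarrow> ('e \<Rightarrow> 'e) \<Rightarrow> ('v, 'e) graph_aut monoid" where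
  "Aut G arev =
     \<lparr>carrier = {\<tau>. is_aut G arev \<tau>},
      monoid.mult = (\<lambda>\<sigma> \<tau>. \<lparr>on_verts = on_verts \<sigma> \<circ> on_verts \<tau>,
                            on_edges = on_edges \<sigma> \<circ> on_edges \<tau>,
                            on_arcs = on_arcs \<sigma> \<circ> on_arcs \<tau>\<rparr>),
      one = \<lparr>on_verts = id, on_edges = id, on_arcs = id\<rparr>\<rparr>"

lemma group_Aut:
  assumes "bidirected_digraph G arev"
  shows "group (Aut G arev)"
proof -
  interpret bidirected_digraph G arev by fact
  have eo: "edge_of arev e \<in> edges G arev" if "e \<in> arcs G" for e
    using that by (simp add: edges_def)
  have eo2: "x = edge_of arev e" if "x \<in> edges G arev" "e \<in> x" for x e
    using that by (auto simp: edges_def edge_of_def)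
  let ?mul = "\<lambda>\<sigma> \<tau>. \<lparr>on_verts = on_verts \<sigma> \<circ> on_verts \<tau>, on_edges = on_edges \<sigma> \<circ> on_edges \<tau>,
                 on_arcs = on_arcs \<sigma> \<circ> on_arcs \<tau>\<rparr> :: ('a, 'b) graph_aut"
  have mul: "is_aut G arev (?mul \<sigma> \<tau>)" if s: "is_aut G arev \<sigma>" and t: "is_aut G arev \<tau>" for \<sigma> \<tau>
  proof -
    have ta: "on_arcs \<tau> e \<in> arcs G" if "e \<in> arcs G" for e
      using t that by (simp add: is_aut_def permutes_in_image)
    have te: "on_edges \<tau> x \<in> edges G arev" if "x \<in> edges G arev" for x
      using t that by (simp add: is_aut_def permutes_in_image)
    have "on_edges \<tau> (edge_of arev e) = edge_of arev (on_arcs \<tau> e)" if "e \<in> arcs G" for e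
      using eo2[OF te[OF eo[OF that]]] t that by (simp add: is_aut_def)
    then show ?thesis
      using s t ta te by (simp add: is_aut_def permutes_compose image_comp)
  qed
  have inv: "\<exists>\<rho>. is_aut G arev \<rho> \<and> ?mul \<rho> \<tau> = \<lparr>on_verts = id, on_edges = id, on_arcs = id\<rparr>"
    if t: "is_aut G arev \<tau>" for \<tau>
  proof -
    let ?v = "on_verts \<tau>" and ?e = "on_edges \<tau>" and ?a = "on_arcs \<tau>"
    have pv: "?v permutes verts G" and pe: "?e permutes edges G arev" and pa: "?a permutes arcs G"
      using t by (auto simp: is_aut_def)
    have ia: "inv_into UNIV ?a e \<in> arcs G" if "e \<in> arcs G" for e
      using permutes_in_image[OF permutes_inv[OF pa]] that by simp
    have ie: "inv_into UNIV ?e x \<in> edges G arev" if "x \<in> edges G arev" for x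
      using permutes_in_image[OF permutes_inv[OF pe]] that by simp
    have te: "?e x \<in> edges G arev" if "x \<in> edges G arev" for x
      using permutes_in_image[OF pe] that by simp
    have 1: "ends G (inv_into UNIV ?e x) = inv_into UNIV ?v ` ends G x" if x: "x \<in> edges G arev" for x
    proof -
      have "ends G (?e (inv_into UNIV ?e x)) = ?v ` ends G (inv_into UNIV ?e x)"
        using t ie[OF x] by (simp add: is_aut_def)
      then have "ends G x = ?v ` ends G (inv_into UNIV ?e x)" by (simp add: permutes_inverses[OF pe])
      then show ?thesis by (simp add: image_comp permutes_inv_o[OF pv])
    qed
    have 2: "inv_into UNIV ?a e \<in> inv_into UNIV ?e (edge_of arev e) \<and> tail G (inv_into UNIV ?a e) = inv_into UNIV ?v (tail G e) \<and>
             inv_into UNIV ?a (arev e) = arev (inv_into UNIV ?a e)" if e: "e \<in> arcs G" for e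
    proof -
      let ?d = "inv_into UNIV ?a e"
      have d: "?d \<in> arcs G" "?a ?d = e" using ia[OF e] by (auto simp: permutes_inverses[OF pa])
      have "?e (edge_of arev ?d) = edge_of arev e"
      proof (rule eo2[OF te[OF eo[OF d(1)]]])
        show "e \<in> ?e (edge_of arev ?d)" using t d unfolding is_aut_def by metis
      qed
      then have "inv_into UNIV ?e (edge_of arev e) = edge_of arev ?d"
        by (metis permutes_inverses(2)[OF pe])
      moreover have "tail G e = ?v (tail G ?d)" "?a (arev ?d) = arev e"
        using t d by (auto simp: is_aut_def)
      ultimately show ?thesis
        by (metis edge_of_def insertI1 permutes_inverses(2)[OF pv] permutes_inverses(2)[OF pa])
    qed
    have "is_aut G arev \<lparr>on_verts = inv_into UNIV ?v, on_edges = inv_into UNIV ?e, on_arcs = inv_into UNIV ?a\<rparr>"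
      using 1 2 by (simp add: is_aut_def permutes_inv[OF pv] permutes_inv[OF pe] permutes_inv[OF pa])
    then show ?thesis
      by (intro exI[of _ "\<lparr>on_verts = inv_into UNIV ?v, on_edges = inv_into UNIV ?e, on_arcs = inv_into UNIV ?a\<rparr>"])
         (simp add: permutes_inv_o[OF pv] permutes_inv_o[OF pe] permutes_inv_o[OF pa])
  qed
  have one: "is_aut G arev \<lparr>on_verts = id, on_edges = id, on_arcs = id\<rparr>"
    by (simp add: is_aut_def permutes_id edge_of_def)
  show ?thesis
    using mul inv one by (intro groupI) (auto simp: Aut_def comp_assoc)
qed


section \<open>Closed walks, circuits, spanning trees\<close>

definition closed_walk :: "('v, 'e) pre_digraph \<Rightarrow> 'e list \<Rightarrow> bool" where
  "closed_walk G p \<longleftrightarrow> p \<noteq> [] \<and> (\<exists>u. pre_digraph.awalk G u p u)"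

definition circuit :: "('v, 'e) pre_digraph \<Rightarrow> ('e \<Rightarrow> 'e) \<Rightarrow> 'e list \<Rightarrow> bool" where
  "circuit G arev p \<longleftrightarrow> closed_walk G p \<and>
     (\<forall>i. Suc i < length p \<longrightarrow> p ! Suc i \<noteq> arev (p ! i)) \<and>
     last p \<noteq> arev (hd p)"

text \<open>
  The library's \<open>tree\<close> and \<open>spanning_tree\<close> are of no use here: they forbid directed cycles, and
  \<open>e e\<inverse>\<close> is one. A cycle of the undirected graph is a directed cycle that is also a circuit.
\<close>
definition spanning_tree_of ::
  "('v, 'e) pre_digraph \<Rightarrow> ('v, 'e) pre_digraph \<Rightarrow> ('e \<Rightarrow> 'e) \<Rightarrow> bool" where
  "spanning_tree_of T G arev \<longleftrightarrow>
     spanning T G \<and> (\<forall>e \<in> arcs T. arev e \<in> arcs T) \<and>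
     Digraph_Component.connected T \<and>
     \<not> (\<exists>p. pre_digraph.cycle T p \<and> circuit T arev p)"


section \<open>Chains and homology modulo t\<close>

text \<open>
  An element of \<open>C\<^sub>1(G, \<int>/t)\<close> is its coefficient function, with residues represented in
  \<open>{0..<t}\<close> and value \<open>0\<close> off the positively oriented edges.
\<close>
definition chains :: "nat \<Rightarrow> 'e set \<Rightarrow> ('e \<Rightarrow> int) set" where
  "chains t Eo = {c. (\<forall>e. c e \<in> {0..<int t}) \<and> (\<forall>e. e \<notin> Eo \<longrightarrow> c e = 0)}"

definition chains_on :: "nat \<Rightarrow> 'e set \<Rightarrow> 'e set \<Rightarrow> ('e \<Rightarrow> int) set" where
  "chains_on t Eo F = {c \<in> chains t Eo. \<forall>e. e \<notin> F \<longrightarrow> c e = 0}"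

definition restr :: "'e set \<Rightarrow> ('e \<Rightarrow> int) \<Rightarrow> 'e \<Rightarrow> int" where
  "restr F c = (\<lambda>e. if e \<in> F then c e else 0)"

definition reduce :: "nat \<Rightarrow> ('e \<Rightarrow> int) \<Rightarrow> 'e \<Rightarrow> int" where
  "reduce t c = (\<lambda>e. c e mod int t)"

definition pairing :: "nat \<Rightarrow> 'e set \<Rightarrow> ('e \<Rightarrow> int) \<Rightarrow> ('e \<Rightarrow> int) \<Rightarrow> int" where
  "pairing t Eo a b = (\<Sum>e\<in>Eo. a e * b e) mod int t"

text \<open>The integral chain \<open>1\<cdot>e\<close>, where \<open>1\<cdot>e = -1\<cdot>e\<inverse>\<close> if \<open>e\<close> is negatively oriented.\<close>
definition arc_chain :: "('e \<Rightarrow> 'e) \<Rightarrow> 'e set \<Rightarrow> 'e \<Rightarrow> 'e \<Rightarrow> int" where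
  "arc_chain arev Eo e =
     (\<lambda>x. if e \<in> Eo \<and> x = e then 1 else if arev e \<in> Eo \<and> x = arev e then - 1 else 0)"

definition walk_ab :: "nat \<Rightarrow> ('e \<Rightarrow> 'e) \<Rightarrow> 'e set \<Rightarrow> 'e list \<Rightarrow> 'e \<Rightarrow> int" where
  "walk_ab t arev Eo p = reduce t (\<lambda>x. \<Sum>e\<leftarrow>p. arc_chain arev Eo e x)"

definition H1 :: "('v, 'e) pre_digraph \<Rightarrow> nat \<Rightarrow> 'e set \<Rightarrow> ('e \<Rightarrow> int) set" where
  "H1 G t Eo = {c \<in> chains t Eo. \<forall>v \<in> verts G.
     (\<Sum>e | e \<in> Eo \<and> tail G e = v. c e) mod int t = (\<Sum>e | e \<in> Eo \<and> head G e = v. c e) mod int t}"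

definition act :: "nat \<Rightarrow> ('e \<Rightarrow> 'e) \<Rightarrow> 'e set \<Rightarrow> ('v, 'e) graph_aut \<Rightarrow> ('e \<Rightarrow> int) \<Rightarrow> 'e \<Rightarrow> int" where
  "act t arev Eo \<tau> c = reduce t (\<lambda>x. \<Sum>e\<in>Eo. c e * arc_chain arev Eo (on_arcs \<tau> e) x)"

text \<open>\<open>S\<close> need not be stable under \<open>H\<close>.\<close>
definition orb :: "nat \<Rightarrow> ('e \<Rightarrow> 'e) \<Rightarrow> 'e set \<Rightarrow> ('v, 'e) graph_aut set \<Rightarrow>
    ('e \<Rightarrow> int) set \<Rightarrow> ('e \<Rightarrow> int) \<Rightarrow> ('e \<Rightarrow> int) set" where
  "orb t arev Eo H S \<gamma> = {act t arev Eo \<tau> \<gamma> |\<tau>. \<tau> \<in> H \<and> act t arev Eo \<tau> \<gamma> \<in> S}"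

definition orbs :: "nat \<Rightarrow> ('e \<Rightarrow> 'e) \<Rightarrow> 'e set \<Rightarrow> ('v, 'e) graph_aut set \<Rightarrow>
    ('e \<Rightarrow> int) set \<Rightarrow> ('e \<Rightarrow> int) set set" where
  "orbs t arev Eo H S = orb t arev Eo H S ` S"


section \<open>Counting functions\<close>

definition num_circuits :: "('v, 'e) pre_digraph \<Rightarrow> ('e \<Rightarrow> 'e) \<Rightarrow> 'e set \<Rightarrow> nat \<Rightarrow> 'e set \<Rightarrow>
    ('e \<Rightarrow> int) \<Rightarrow> nat \<Rightarrow> nat" where
  "num_circuits G arev Eo t F \<alpha> l =
     card {p. circuit G arev p \<and> length p = l \<and> restr F (walk_ab t arev Eo p) = \<alpha>}"

definition num_closed_walks :: "('v, 'e) pre_digraph \<Rightarrow> ('e \<Rightarrow> 'e) \<Rightarrow> 'e set \<Rightarrow> nat \<Rightarrow> 'e set \<Rightarrow>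
    ('e \<Rightarrow> int) \<Rightarrow> nat \<Rightarrow> nat" where
  "num_closed_walks G arev Eo t F \<alpha> l =
     card {p. closed_walk G p \<and> length p = l \<and> restr F (walk_ab t arev Eo p) = \<alpha>}"


section \<open>Twisted adjacency matrices\<close>

definition root_of_unity :: "nat \<Rightarrow> complex" where
  "root_of_unity t = exp (2 * of_real pi * \<i> / of_nat t)"

definition chi :: "nat \<Rightarrow> ('e \<Rightarrow> 'e) \<Rightarrow> 'e set \<Rightarrow> ('e \<Rightarrow> int) \<Rightarrow> 'e \<Rightarrow> complex" where
  "chi t arev Eo \<gamma> e = root_of_unity t powi pairing t Eo \<gamma> (reduce t (arc_chain arev Eo e))"

text \<open>The list \<open>vs\<close> enumerates the vertices as \<open>v\<^sub>1, \<dots>, v\<^sub>n\<close>.\<close>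
definition adj_mat :: "('v, 'e) pre_digraph \<Rightarrow> ('e \<Rightarrow> 'e) \<Rightarrow> 'e set \<Rightarrow> 'v list \<Rightarrow> nat \<Rightarrow>
    ('e \<Rightarrow> int) \<Rightarrow> complex mat" where
  "adj_mat G arev Eo vs t \<gamma> = mat (length vs) (length vs)
     (\<lambda>(i, j). \<Sum>e | e \<in> arcs G \<and> tail G e = vs ! i \<and> head G e = vs ! j. chi t arev Eo \<gamma> e)"

definition feeds_into :: "('v, 'e) pre_digraph \<Rightarrow> ('e \<Rightarrow> 'e) \<Rightarrow> 'e \<Rightarrow> 'e \<Rightarrow> bool" where
  "feeds_into G arev e e' \<longleftrightarrow> e' \<noteq> arev e \<and> head G e = tail G e'"

text \<open>The list \<open>es\<close> enumerates the oriented edges.\<close>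
definition edge_adj_mat :: "('v, 'e) pre_digraph \<Rightarrow> ('e \<Rightarrow> 'e) \<Rightarrow> 'e set \<Rightarrow> 'e list \<Rightarrow> nat \<Rightarrow>
    ('e \<Rightarrow> int) \<Rightarrow> complex mat" where
  "edge_adj_mat G arev Eo es t \<gamma> = mat (length es) (length es)
     (\<lambda>(i, j). if feeds_into G arev (es ! i) (es ! j) then chi t arev Eo \<gamma> (es ! i) else 0)"

definition mat_trace :: "'a :: comm_monoid_add mat \<Rightarrow> 'a" where
  "mat_trace A = (\<Sum>i<dim_row A. A $$ (i, i))"

end

theory Submission
  imports Defs
begin

text \<open>
  The trace of the \<open>l\<close>-th power of a twisted matrix is the sum of the character \<open>\<chi>\<^sub>\<gamma>\<close> over the closed
  walks (or circuits) of length \<open>l\<close>, and \<open>\<chi>\<^sub>\<gamma>\<close> of a walk depends only on its class modulo \<open>t\<close>.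
  Orthogonality of the characters of \<open>M\<^sub>t(F)\<close> then isolates the walks with a prescribed restriction to
  \<open>F\<close>. An automorphism permutes the closed walks and the circuits, so the traces are constant on
  orbits. For a spanning tree, a class in \<open>H\<^sub>1\<close> is determined by its restriction to the
  complement of the tree, since the support of a cycle has no leaves, and that complement has \<open>g\<close> edges.
\<close>

section \<open>Characters of the chain group\<close>

text \<open>Chains are canonical representatives with values in \<open>{0..<t}\<close>, so the
  pairing, the action and the class of a walk involve reductions modulo t. The proof therefore
  computes with integer exponents and divisibility by t, and goes back to equality of chains only
  through uniqueness of representatives. A second obstacle is orientation: an automorphism may send
  a positive arc to a negative one. Extending a chain antisymmetrically to all arcs
  (\<open>coeff_at\<close>) turns the action into a plain change of variable, and the boundary at a
  vertex into a sum over the arcs leaving it. Third, the chains supported on F need not be stable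
  under H; the classes are the H-orbits cut down to this set, and they still partition it because H
  is a group. Finally, an \<alpha> in the homology is in general not supported off the tree. It is
  replaced by its restriction there: this leaves the pairings with chains supported off the tree
  unchanged, and a closed walk has class \<alpha> exactly when its restriction is that of
  \<alpha>.\<close>

lemma root_of_unity_cis: "root_of_unity t = cis (2 * pi / real t)"
  by (simp add: root_of_unity_def cis_conv_exp mult.commute)

lemma root_of_unity_nonzero [simp]: "root_of_unity t \<noteq> 0"
  by (simp add: root_of_unity_cis)

lemma root_of_unity_powi_eq_1_iff:
  assumes "t > 0"
  shows "root_of_unity t powi k = 1 \<longleftrightarrow> int t dvd k"
proof -
  \<comment> \<open>A point of the unit circle equals 1 as soon as its cosine is 1, so only the real
    part has to be examined.\<close>
  have "root_of_unity t powi k = 1 \<longleftrightarrow> cos (of_int k * (2 * pi / real t)) = 1"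
    by (auto simp: root_of_unity_cis cis_power_int complex_eq_iff cos_one_sin_zero)
  also have "\<dots> \<longleftrightarrow> (\<exists>n::int. of_int k * (2 * pi / real t) = of_int n * 2 * pi)"
    by (simp add: cos_one_2pi_int)
  also have "\<dots> \<longleftrightarrow> (\<exists>n::int. real_of_int k = real_of_int (int t * n))"
    using assms by (simp add: field_simps)
  also have "\<dots> \<longleftrightarrow> int t dvd k"
    unfolding of_int_eq_iff by (auto simp: dvd_def)
  finally show ?thesis .
qed

lemma root_of_unity_powi_cong:
  assumes "t > 0" "a mod int t = b mod int t"
  shows "root_of_unity t powi a = root_of_unity t powi b"
proof -
  have "root_of_unity t powi (a - b) = 1"
    using assms by (simp add: root_of_unity_powi_eq_1_iff mod_eq_dvd_iff)
  then show ?thesis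
    by (simp add: power_int_diff)
qed

lemma power_int_sum:
  fixes w :: "'a :: field"
  assumes "w \<noteq> 0"
  shows "w powi (\<Sum>x\<in>A. f x) = (\<Prod>x\<in>A. w powi f x)"
  using assms by (induction A rule: infinite_finite_induct) (auto simp: power_int_add)

text \<open>A geometric sum whose ratio is a t-th root of unity: the ratio is 1 exactly when t
  divides d, and otherwise the sum runs over full periods and vanishes.\<close>

lemma sum_root_of_unity_powi:
  assumes "t > 0"
  shows "(\<Sum>k\<in>{0..<int t}. root_of_unity t powi (k * d)) = (if d mod int t = 0 then of_nat t else 0)"
proof -
  let ?z = "root_of_unity t powi d"
  have "(\<Sum>k\<in>{0..<int t}. root_of_unity t powi (k * d)) = (\<Sum>k<t. ?z ^ k)"
    by (rule sum.reindex_bij_witness[of _ int nat])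
       (auto simp: power_int_mult mult.commute[of _ d] simp flip: power_int_of_nat)
  also have "\<dots> = (if d mod int t = 0 then of_nat t else 0)"
  proof (cases "int t dvd d")
    case True
    then have "?z = 1"
      using assms by (simp add: root_of_unity_powi_eq_1_iff)
    with True show ?thesis
      by (simp add: dvd_eq_mod_eq_0)
  next
    case False
    have "?z ^ t = root_of_unity t powi (d * int t)"
      by (simp add: power_int_mult)
    also have "\<dots> = 1"
      using assms by (simp add: root_of_unity_powi_eq_1_iff)
    finally have "(\<Sum>k<t. ?z ^ k) = 0"
      using assms False by (subst geometric_sum) (auto simp: root_of_unity_powi_eq_1_iff)
    with False show ?thesis
      by (simp add: dvd_eq_mod_eq_0)
  qed
  finally show ?thesis .
qed

text \<open>Extensional functions are undefined off F, chains are 0 there. Changing the default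
  value makes the interchange of product and sum over \<open>PiE\<close> available for
  chains.\<close>

lemma bij_betw_restr_chains:
  assumes "t > 0"
  shows "bij_betw (restr F) (F \<rightarrow>\<^sub>E {0..<int t}) (chains t F)"
  by (rule bij_betw_byWitness[where f' = "\<lambda>c. restrict c F"])
     (use assms in \<open>force simp: restr_def chains_def PiE_def extensional_def fun_eq_iff\<close>)+

text \<open>Distributivity. It serves twice: with characters as factors it gives orthogonality, with
  all factors 1 it counts the chains.\<close>

lemma sum_chains_prod:
  fixes f :: "'e \<Rightarrow> int \<Rightarrow> 'a :: comm_semiring_1"
  assumes "t > 0" "finite F"
  shows "(\<Sum>c\<in>chains t F. \<Prod>e\<in>F. f e (c e)) = (\<Prod>e\<in>F. \<Sum>k\<in>{0..<int t}. f e k)"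
proof -
  have "(\<Sum>c\<in>chains t F. \<Prod>e\<in>F. f e (c e)) =
        (\<Sum>c\<in>F \<rightarrow>\<^sub>E {0..<int t}. \<Prod>e\<in>F. f e (restr F c e))"
    by (rule sum.reindex_bij_betw[OF bij_betw_restr_chains[OF assms(1)], symmetric])
  also have "\<dots> = (\<Sum>c\<in>F \<rightarrow>\<^sub>E {0..<int t}. \<Prod>e\<in>F. f e (c e))"
    by (simp add: restr_def)
  also have "\<dots> = (\<Prod>e\<in>F. \<Sum>k\<in>{0..<int t}. f e k)"
    using assms(2) by (simp add: prod_sum_PiE)
  finally show ?thesis .
qed

lemma finite_chains:
  assumes "t > 0" "finite F"
  shows "finite (chains t F)"
  using bij_betw_finite[OF bij_betw_restr_chains[OF assms(1), of F]] assms(2)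
  by (simp add: finite_PiE)

lemma card_chains:
  assumes "t > 0" "finite F"
  shows "card (chains t F) = t ^ card F"
  using sum_chains_prod[OF assms, of "\<lambda>_ _. 1 :: nat"] by simp

lemma chains_on_eq:
  assumes "F \<subseteq> Eo"
  shows "chains_on t Eo F = chains t F"
  using assms by (auto simp: chains_on_def chains_def)

lemma chain_mod:
  assumes "c \<in> chains t F"
  shows "c e mod int t = c e"
  using assms by (simp add: chains_def)

lemma chains_eqI:
  assumes "a \<in> chains t F" "b \<in> chains t F" "\<And>e. e \<in> F \<Longrightarrow> a e mod int t = b e mod int t"
  shows "a = b"
proof
  fix e
  show "a e = b e"
    using assms by (cases "e \<in> F") (auto simp: chain_mod chains_def)
qed

text \<open>The character is a product over the coordinates, so the sum factors; each coordinate
  contributes t or 0, and one coordinate of d not divisible by t annihilates everything.\<close>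

lemma sum_chains_root_of_unity:
  assumes "t > 0" "finite F"
  shows "(\<Sum>c\<in>chains t F. root_of_unity t powi (\<Sum>e\<in>F. c e * d e)) =
         (if \<forall>e\<in>F. d e mod int t = 0 then of_nat t ^ card F else 0)"
proof -
  have "(\<Sum>c\<in>chains t F. root_of_unity t powi (\<Sum>e\<in>F. c e * d e)) =
        (\<Prod>e\<in>F. if d e mod int t = 0 then of_nat t else 0)"
    using sum_chains_prod[OF assms, of "\<lambda>e k. root_of_unity t powi (k * d e)"]
    by (simp only: power_int_sum root_of_unity_nonzero not_False_eq_True
          sum_root_of_unity_powi[OF assms(1)])
  also have "\<dots> = (if \<forall>e\<in>F. d e mod int t = 0 then of_nat t ^ card F else 0)"
    using assms(2) by auto
  finally show ?thesis .
qed

section \<open>Oriented multigraphs\<close>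

text \<open>The antisymmetric extension of a chain from the positive arcs to all arcs, that is, the
  integral pairing of c with \<open>1\<cdot>e\<close>. It no longer favours one orientation of an
  edge, which matters because automorphisms need not preserve \<open>Eo\<close>.\<close>

definition coeff_at :: "('e \<Rightarrow> 'e) \<Rightarrow> 'e set \<Rightarrow> ('e \<Rightarrow> int) \<Rightarrow> 'e \<Rightarrow> int" where
  "coeff_at arev Eo c e = (if e \<in> Eo then c e else - c (arev e))"

locale oriented_multigraph = multigraph G arev
  for G :: "('v, 'e) pre_digraph" and arev :: "'e \<Rightarrow> 'e" +
  fixes Eo :: "'e set" and t :: nat
  assumes orientation: "orientation G arev Eo" and t_pos: "t > 0"
begin

lemma Eo_subset: "Eo \<subseteq> arcs G"
  using orientation by (simp add: orientation_def)

lemma Eo_arc: "e \<in> Eo \<Longrightarrow> e \<in> arcs G"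
  using Eo_subset by blast

lemma arev_in_Eo_iff: "e \<in> arcs G \<Longrightarrow> arev e \<in> Eo \<longleftrightarrow> e \<notin> Eo"
  using orientation unfolding orientation_def by blast

lemma finite_Eo: "finite Eo"
  by (rule finite_subset[OF Eo_subset finite_arcs])

lemma coeff_at_arev: "e \<in> arcs G \<Longrightarrow> coeff_at arev Eo c (arev e) = - coeff_at arev Eo c e"
  by (simp add: coeff_at_def arev_in_Eo_iff)

lemma sum_arc_chain:
  assumes "e \<in> arcs G"
  shows "(\<Sum>x\<in>Eo. c x * arc_chain arev Eo e x) = coeff_at arev Eo c e"
proof (cases "e \<in> Eo")
  case True
  then have "(\<Sum>x\<in>Eo. c x * arc_chain arev Eo e x) = (\<Sum>x\<in>Eo. if x = e then c x else 0)"
    using assms by (intro sum.cong) (auto simp: arc_chain_def arev_in_Eo_iff)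
  with True show ?thesis
    by (simp add: finite_Eo coeff_at_def)
next
  case False
  then have "(\<Sum>x\<in>Eo. c x * arc_chain arev Eo e x) = (\<Sum>x\<in>Eo. if x = arev e then - c x else 0)"
    using assms by (intro sum.cong) (auto simp: arc_chain_def arev_in_Eo_iff)
  with False show ?thesis
    using assms by (simp add: finite_Eo coeff_at_def arev_in_Eo_iff)
qed

lemma pairing_reduce: "pairing t Eo a (reduce t b) = (\<Sum>e\<in>Eo. a e * b e) mod int t"
proof -
  have "(\<Sum>e\<in>Eo. a e * (b e mod int t)) mod int t = (\<Sum>e\<in>Eo. a e * (b e mod int t) mod int t) mod int t"
    by (simp only: mod_sum_eq)
  also have "\<dots> = (\<Sum>e\<in>Eo. a e * b e) mod int t"
    by (simp only: mod_mult_right_eq mod_sum_eq)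
  finally show ?thesis
    by (simp add: pairing_def reduce_def)
qed

lemma chi_eq:
  assumes "e \<in> arcs G"
  shows "chi t arev Eo c e = root_of_unity t powi coeff_at arev Eo c e"
  unfolding chi_def pairing_reduce
  by (rule root_of_unity_powi_cong[OF t_pos]) (simp add: sum_arc_chain assms)

text \<open>Exponents add along the walk, and exchanging the sum over the walk with the sum over
  \<open>Eo\<close> leaves the pairing with its abelianization. Reducing that modulo t does not
  change the power of a t-th root of unity.\<close>

lemma prod_chi_eq:
  assumes "set p \<subseteq> arcs G"
  shows "(\<Prod>e\<leftarrow>p. chi t arev Eo c e) = root_of_unity t powi (\<Sum>x\<in>Eo. c x * walk_ab t arev Eo p x)"
proof -
  have "(\<Prod>e\<leftarrow>p. chi t arev Eo c e) = root_of_unity t powi (\<Sum>e\<leftarrow>p. coeff_at arev Eo c e)"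
    using assms by (induction p) (auto simp: power_int_add chi_eq)
  also have "(\<Sum>e\<leftarrow>p. coeff_at arev Eo c e) = (\<Sum>x\<in>Eo. c x * (\<Sum>e\<leftarrow>p. arc_chain arev Eo e x))"
    using assms by (induction p) (auto simp: distrib_left sum.distrib sum_arc_chain)
  also have "root_of_unity t powi \<dots> = root_of_unity t powi (\<Sum>x\<in>Eo. c x * walk_ab t arev Eo p x)"
    using pairing_reduce[of c "\<lambda>x. \<Sum>e\<leftarrow>p. arc_chain arev Eo e x"]
    by (intro root_of_unity_powi_cong[OF t_pos]) (simp add: walk_ab_def pairing_def)
  finally show ?thesis .
qed

lemma walk_ab_chain: "walk_ab t arev Eo p \<in> chains t Eo"
proof -
  have "(\<Sum>e\<leftarrow>p. arc_chain arev Eo e x) = 0" if "x \<notin> Eo" for x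
    using that by (induction p) (auto simp: arc_chain_def)
  then show ?thesis
    using t_pos by (simp add: walk_ab_def chains_def reduce_def)
qed

lemma restr_chain: "c \<in> chains t Eo \<Longrightarrow> restr F c \<in> chains t F"
  using t_pos by (auto simp: chains_def restr_def)

text \<open>Orthogonality of characters, applied walk by walk.\<close>
lemma card_walks_with_restriction:
  assumes "finite C" "\<And>p. p \<in> C \<Longrightarrow> set p \<subseteq> arcs G" "F \<subseteq> Eo" "\<alpha> \<in> chains t F"
  shows "of_nat (card {p \<in> C. restr F (walk_ab t arev Eo p) = \<alpha>}) =
    1 / of_nat t ^ card F * (\<Sum>\<gamma>\<in>chains t F. root_of_unity t powi (- pairing t Eo \<gamma> \<alpha>) *
      (\<Sum>p\<in>C. \<Prod>e\<leftarrow>p. chi t arev Eo \<gamma> e))"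
proof -
  let ?w = "\<lambda>p. walk_ab t arev Eo p" and ?z = "root_of_unity t"
  have fin: "finite F"
    by (rule finite_subset[OF assms(3) finite_Eo])
  have zero: "c e = 0" if "c \<in> chains t F" "e \<in> Eo - F" for c e
    using that by (auto simp: chains_def)
  have 1: "?z powi (- pairing t Eo \<gamma> \<alpha>) * (\<Prod>e\<leftarrow>p. chi t arev Eo \<gamma> e) =
           ?z powi (\<Sum>e\<in>F. \<gamma> e * (?w p e - \<alpha> e))" if "\<gamma> \<in> chains t F" "p \<in> C" for \<gamma> p
  proof -
    \<comment> \<open>The negated pairing is only congruent to the negated sum, which is all that an
      exponent of this root needs.\<close>
    have "?z powi (- pairing t Eo \<gamma> \<alpha>) = ?z powi (- (\<Sum>e\<in>Eo. \<gamma> e * \<alpha> e))"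
      by (rule root_of_unity_powi_cong[OF t_pos]) (simp add: pairing_def mod_minus_eq)
    then have "?z powi (- pairing t Eo \<gamma> \<alpha>) * (\<Prod>e\<leftarrow>p. chi t arev Eo \<gamma> e) =
        ?z powi (\<Sum>e\<in>Eo. \<gamma> e * (?w p e - \<alpha> e))"
      using assms(2)[OF that(2)]
      by (simp add: prod_chi_eq sum_subtractf right_diff_distrib add.commute flip: power_int_add)
    also have "(\<Sum>e\<in>Eo. \<gamma> e * (?w p e - \<alpha> e)) = (\<Sum>e\<in>F. \<gamma> e * (?w p e - \<alpha> e))"
      using assms(3) zero[OF that(1)] finite_Eo by (intro sum.mono_neutral_right) auto
    finally show ?thesis .
  qed
  have 2: "(\<forall>e\<in>F. (?w p e - \<alpha> e) mod int t = 0) \<longleftrightarrow> restr F (?w p) = \<alpha>" if "p \<in> C" for p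
  proof -
    have "restr F (?w p) \<in> chains t F"
      by (intro restr_chain walk_ab_chain)
    then have "restr F (?w p) = \<alpha> \<longleftrightarrow> (\<forall>e\<in>F. restr F (?w p) e mod int t = \<alpha> e mod int t)"
      using chains_eqI[OF _ assms(4)] by blast
    then show ?thesis
      by (simp add: restr_def mod_eq_dvd_iff dvd_eq_mod_eq_0)
  qed
  have "(\<Sum>\<gamma>\<in>chains t F. ?z powi (- pairing t Eo \<gamma> \<alpha>) * (\<Sum>p\<in>C. \<Prod>e\<leftarrow>p. chi t arev Eo \<gamma> e)) =
        (\<Sum>\<gamma>\<in>chains t F. \<Sum>p\<in>C. ?z powi (\<Sum>e\<in>F. \<gamma> e * (?w p e - \<alpha> e)))"
    by (simp add: sum_distrib_left 1)
  \<comment> \<open>With the walk fixed, the inner sum over \<gamma> is the indicator, scaled by the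
    number of chains on F, of the event that the walk restricts to \<alpha>.\<close>
  also have "\<dots> = (\<Sum>p\<in>C. if restr F (?w p) = \<alpha> then of_nat t ^ card F else 0)"
    by (subst sum.swap) (simp add: sum_chains_root_of_unity[OF t_pos fin] 2)
  also have "\<dots> = of_nat (card {p \<in> C. restr F (?w p) = \<alpha>}) * of_nat t ^ card F"
    using assms(1) by (simp flip: sum.inter_filter)
  finally show ?thesis
    using t_pos by simp
qed

section \<open>Automorphisms acting on arcs, chains and characters\<close>

lemma aut_arc: "is_aut G arev \<tau> \<Longrightarrow> e \<in> arcs G \<Longrightarrow> on_arcs \<tau> e \<in> arcs G"
  by (simp add: is_aut_def permutes_in_image)

lemma aut_arev: "is_aut G arev \<tau> \<Longrightarrow> e \<in> arcs G \<Longrightarrow> on_arcs \<tau> (arev e) = arev (on_arcs \<tau> e)"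
  by (simp add: is_aut_def)

lemma aut_inj: "is_aut G arev \<tau> \<Longrightarrow> on_arcs \<tau> e = on_arcs \<tau> e' \<longleftrightarrow> e = e'"
  using permutes_inj[of "on_arcs \<tau>" "arcs G"] by (auto simp: is_aut_def dest: injD)

lemma aut_surj: "is_aut G arev \<tau> \<Longrightarrow> e \<in> arcs G \<Longrightarrow> \<exists>e'\<in>arcs G. on_arcs \<tau> e' = e"
proof -
  assume "is_aut G arev \<tau>" and e: "e \<in> arcs G"
  then have "on_arcs \<tau> ` arcs G = arcs G"
    by (intro permutes_image) (simp add: is_aut_def)
  with e show ?thesis
    by (metis imageE)
qed

lemma aut_tail: "is_aut G arev \<tau> \<Longrightarrow> e \<in> arcs G \<Longrightarrow> tail G (on_arcs \<tau> e) = on_verts \<tau> (tail G e)"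
  by (simp add: is_aut_def)

lemma aut_head: "is_aut G arev \<tau> \<Longrightarrow> e \<in> arcs G \<Longrightarrow> head G (on_arcs \<tau> e) = on_verts \<tau> (head G e)"
  using aut_tail[of \<tau> "arev e"] by (simp add: aut_arev aut_arc)

lemma act_chain: "act t arev Eo \<tau> c \<in> chains t Eo"
proof -
  have "(\<Sum>e\<in>Eo. c e * arc_chain arev Eo (on_arcs \<tau> e) x) = 0" if "x \<notin> Eo" for x
    using that by (intro sum.neutral) (auto simp: arc_chain_def)
  then show ?thesis
    using t_pos by (simp add: act_def reduce_def chains_def)
qed

text \<open>If the image of e is positive, only the summands at e and at its reverse reach it, and
  exactly one of these two arcs lies in \<open>Eo\<close>; the signs add up to
  \<open>coeff_at\<close>. A negative image follows by passing to the reverse of e. Only a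
  congruence can hold, since \<open>act\<close> reduces and negation leaves the range of
  representatives.\<close>

lemma coeff_at_act:
  assumes \<tau>: "is_aut G arev \<tau>" and e: "e \<in> arcs G"
  shows "coeff_at arev Eo (act t arev Eo \<tau> c) (on_arcs \<tau> e) mod int t = coeff_at arev Eo c e mod int t"
proof -
  have *: "act t arev Eo \<tau> c (on_arcs \<tau> e) = coeff_at arev Eo c e mod int t"
    if e: "e \<in> arcs G" "on_arcs \<tau> e \<in> Eo" for e
  proof -
    have "c x * arc_chain arev Eo (on_arcs \<tau> x) (on_arcs \<tau> e) =
          (if x = e then c x else 0) + (if x = arev e then - c x else 0)" if "x \<in> Eo" for x
    proof -
      have x: "x \<in> arcs G"
        using that by (rule Eo_arc)
      have 1: "arc_chain arev Eo (on_arcs \<tau> x) (on_arcs \<tau> e) =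
            (if on_arcs \<tau> x = on_arcs \<tau> e then 1 else if arev (on_arcs \<tau> x) = on_arcs \<tau> e then - 1 else 0)"
        using e(2) by (auto simp: arc_chain_def)
      have 2: "arev (on_arcs \<tau> x) = on_arcs \<tau> e \<longleftrightarrow> x = arev e"
        by (metis arev_arev aut_arev[OF \<tau> x] aut_inj[OF \<tau>])
      show ?thesis
        unfolding 1 2 aut_inj[OF \<tau>] using arev_neq[OF e(1)] by auto
    qed
    then have "act t arev Eo \<tau> c (on_arcs \<tau> e) =
      (\<Sum>x\<in>Eo. (if x = e then c x else 0) + (if x = arev e then - c x else 0)) mod int t"
      by (simp add: act_def reduce_def)
    also have "\<dots> = coeff_at arev Eo c e mod int t"
      using e(1) by (simp add: sum.distrib finite_Eo coeff_at_def arev_in_Eo_iff)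
    finally show ?thesis .
  qed
  show ?thesis
  proof (cases "on_arcs \<tau> e \<in> Eo")
    case True
    then show ?thesis
      using *[OF e] by (simp add: coeff_at_def)
  next
    case False
    then have "on_arcs \<tau> (arev e) \<in> Eo"
      using e by (simp add: aut_arev[OF \<tau>] arev_in_Eo_iff aut_arc[OF \<tau>])
    with *[of "arev e"] e have "act t arev Eo \<tau> c (arev (on_arcs \<tau> e)) = - coeff_at arev Eo c e mod int t"
      by (simp add: aut_arev[OF \<tau>] coeff_at_arev)
    with False show ?thesis
      by (simp add: coeff_at_def[of _ _ "act t arev Eo \<tau> c"] mod_minus_eq)
  qed
qed

lemma chi_act:
  assumes "is_aut G arev \<tau>" "e \<in> arcs G"
  shows "chi t arev Eo (act t arev Eo \<tau> c) (on_arcs \<tau> e) = chi t arev Eo c e"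
  using assms by (simp add: chi_eq aut_arc root_of_unity_powi_cong[OF t_pos coeff_at_act])

lemma chains_eq_if_coeff_at_cong:
  assumes "a \<in> chains t Eo" "b \<in> chains t Eo"
    and "\<And>e. e \<in> arcs G \<Longrightarrow> coeff_at arev Eo a e mod int t = coeff_at arev Eo b e mod int t"
  shows "a = b"
proof (rule chains_eqI[OF assms(1,2)])
  fix e assume "e \<in> Eo"
  with assms(3)[of e] Eo_arc[of e] show "a e mod int t = b e mod int t"
    by (simp add: coeff_at_def)
qed

text \<open>Every arc is the image of some arc under the composite. Pulling coefficients back along
  the composite, or along one factor after the other, leads to the same coefficient of c.\<close>

lemma act_mult:
  assumes "\<sigma> \<in> carrier (Aut G arev)" "\<tau> \<in> carrier (Aut G arev)"
  shows "act t arev Eo (\<sigma> \<otimes>\<^bsub>Aut G arev\<^esub> \<tau>) c = act t arev Eo \<sigma> (act t arev Eo \<tau> c)"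
proof (rule chains_eq_if_coeff_at_cong[OF act_chain act_chain])
  interpret Aut: group "Aut G arev"
    by (rule group_Aut) (rule bidirected_digraph)
  let ?\<rho> = "\<sigma> \<otimes>\<^bsub>Aut G arev\<^esub> \<tau>"
  have \<sigma>: "is_aut G arev \<sigma>" and \<tau>: "is_aut G arev \<tau>" and \<rho>: "is_aut G arev ?\<rho>"
    using assms Aut.m_closed[OF assms] by (auto simp: Aut_def)
  have arcs: "on_arcs ?\<rho> e = on_arcs \<sigma> (on_arcs \<tau> e)" for e
    by (simp add: Aut_def)
  fix e assume "e \<in> arcs G"
  then obtain e' where e': "e' \<in> arcs G" "e = on_arcs ?\<rho> e'"
    using aut_surj[OF \<rho>] by metis
  then have "coeff_at arev Eo (act t arev Eo ?\<rho> c) e mod int t = coeff_at arev Eo c e' mod int t"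
    using coeff_at_act[OF \<rho>] by simp
  also have "\<dots> = coeff_at arev Eo (act t arev Eo \<sigma> (act t arev Eo \<tau> c)) e mod int t"
    using e' coeff_at_act[OF \<sigma> aut_arc[OF \<tau>], of e'] coeff_at_act[OF \<tau>, of e'] by (simp add: arcs)
  finally show "coeff_at arev Eo (act t arev Eo ?\<rho> c) e mod int t =
      coeff_at arev Eo (act t arev Eo \<sigma> (act t arev Eo \<tau> c)) e mod int t" .
qed

lemma act_one:
  assumes "c \<in> chains t Eo"
  shows "act t arev Eo \<one>\<^bsub>Aut G arev\<^esub> c = c"
proof (rule chains_eq_if_coeff_at_cong[OF act_chain assms])
  interpret Aut: group "Aut G arev"
    by (rule group_Aut) (rule bidirected_digraph)
  have "is_aut G arev \<one>\<^bsub>Aut G arev\<^esub>"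
    using Aut.one_closed by (simp add: Aut_def)
  moreover have "on_arcs \<one>\<^bsub>Aut G arev\<^esub> e = e" for e :: 'e
    by (simp add: Aut_def)
  ultimately show "coeff_at arev Eo (act t arev Eo \<one>\<^bsub>Aut G arev\<^esub> c) e mod int t = coeff_at arev Eo c e mod int t"
    if "e \<in> arcs G" for e
    using coeff_at_act that by metis
qed

text \<open>Lying in one class is an equivalence relation on S although S may not be H-stable:
  composites and inverses are taken in H, and only the chains being compared have to lie in S.
  Grouping S by class then pulls the constant value of f out of each inner sum.\<close>

lemma sum_orbs:
  fixes w f :: "('e \<Rightarrow> int) \<Rightarrow> complex"
  assumes H: "subgroup H (Aut G arev)" and S: "finite S" "S \<subseteq> chains t Eo"
    and rep: "\<And>c. c \<in> orbs t arev Eo H S \<Longrightarrow> rep c \<in> c"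
    and inv: "\<And>\<tau> \<gamma>. \<tau> \<in> H \<Longrightarrow> f (act t arev Eo \<tau> \<gamma>) = f \<gamma>"
  shows "(\<Sum>\<gamma>\<in>S. w \<gamma> * f \<gamma>) = (\<Sum>c\<in>orbs t arev Eo H S. (\<Sum>\<gamma>\<in>c. w \<gamma>) * f (rep c))"
proof -
  interpret Aut: group "Aut G arev"
    by (rule group_Aut) (rule bidirected_digraph)
  interpret H: subgroup H "Aut G arev"
    by (rule H)
  let ?o = "orb t arev Eo H S"
  have orbI: "act t arev Eo \<tau> \<gamma> \<in> ?o \<gamma>" if "\<tau> \<in> H" "act t arev Eo \<tau> \<gamma> \<in> S" for \<tau> \<gamma>
    using that by (auto simp: orb_def)
  \<comment> \<open>The identity returns the reduced chain, so it fixes \<gamma> only because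
    members of S are canonical representatives.\<close>
  have refl: "\<gamma> \<in> ?o \<gamma>" if "\<gamma> \<in> S" for \<gamma>
    using orbI[OF H.one_closed, of \<gamma>] act_one[of \<gamma>] that S(2) by auto
  have sub: "?o \<gamma>' \<subseteq> ?o \<gamma>" if \<gamma>': "\<gamma>' \<in> ?o \<gamma>" for \<gamma> \<gamma>'
  proof
    fix \<delta> assume "\<delta> \<in> ?o \<gamma>'"
    then obtain \<sigma> where \<sigma>: "\<sigma> \<in> H" "\<delta> = act t arev Eo \<sigma> \<gamma>'" "\<delta> \<in> S"
      by (auto simp: orb_def)
    obtain \<tau> where \<tau>: "\<tau> \<in> H" "\<gamma>' = act t arev Eo \<tau> \<gamma>"
      using \<gamma>' by (auto simp: orb_def)
    have "\<delta> = act t arev Eo (\<sigma> \<otimes>\<^bsub>Aut G arev\<^esub> \<tau>) \<gamma>"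
      using \<sigma> \<tau> by (simp add: act_mult)
    with \<sigma> \<tau> show "\<delta> \<in> ?o \<gamma>"
      using orbI H.m_closed by metis
  qed
  have sym: "\<gamma> \<in> ?o \<gamma>'" if \<gamma>': "\<gamma>' \<in> ?o \<gamma>" and \<gamma>: "\<gamma> \<in> S" for \<gamma> \<gamma>'
  proof -
    obtain \<tau> where \<tau>: "\<tau> \<in> H" "\<gamma>' = act t arev Eo \<tau> \<gamma>"
      using \<gamma>' by (auto simp: orb_def)
    let ?i = "inv\<^bsub>Aut G arev\<^esub> \<tau>"
    have i: "?i \<in> H"
      using \<tau>(1) by (rule H.m_inv_closed)
    have "act t arev Eo ?i \<gamma>' = act t arev Eo (?i \<otimes>\<^bsub>Aut G arev\<^esub> \<tau>) \<gamma>"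
      using \<tau> i by (simp only: act_mult H.mem_carrier)
    also have "\<dots> = \<gamma>"
      using \<tau> \<gamma> S(2) by (simp add: Aut.l_inv act_one subset_iff)
    finally show ?thesis
      using orbI[OF i, of \<gamma>'] \<gamma> by simp
  qed
  have fibre: "{\<gamma> \<in> S. ?o \<gamma> = c} = c" if c: "c \<in> orbs t arev Eo H S" for c
  proof -
    obtain \<gamma>\<^sub>0 where \<gamma>\<^sub>0: "\<gamma>\<^sub>0 \<in> S" "c = ?o \<gamma>\<^sub>0"
      using c by (auto simp: orbs_def)
    have "?o \<gamma> = c" if "\<gamma> \<in> c" for \<gamma>
      using sub[of \<gamma> \<gamma>\<^sub>0] sub[OF sym[of \<gamma> \<gamma>\<^sub>0]] that \<gamma>\<^sub>0 by blast
    moreover have "c \<subseteq> S"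
      using \<gamma>\<^sub>0 by (auto simp: orb_def)
    ultimately show ?thesis
      using refl by blast
  qed
  have const: "f \<gamma> = f (rep c)" if c: "c \<in> orbs t arev Eo H S" and "\<gamma> \<in> c" for c \<gamma>
  proof -
    obtain \<gamma>\<^sub>0 where "c = ?o \<gamma>\<^sub>0"
      using c by (auto simp: orbs_def)
    with \<open>\<gamma> \<in> c\<close> rep[OF c] show ?thesis
      by (auto simp: orb_def inv)
  qed
  have "(\<Sum>\<gamma>\<in>S. w \<gamma> * f \<gamma>) = (\<Sum>c\<in>orbs t arev Eo H S. \<Sum>\<gamma>\<in>{\<gamma> \<in> S. ?o \<gamma> = c}. w \<gamma> * f \<gamma>)"
    by (rule sum.group[symmetric]) (auto simp: orbs_def S(1))
  also have "\<dots> = (\<Sum>c\<in>orbs t arev Eo H S. \<Sum>\<gamma>\<in>c. w \<gamma> * f (rep c))"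
    by (intro sum.cong) (simp_all add: fibre const)
  finally show ?thesis
    by (simp add: sum_distrib_right)
qed

end

section \<open>Traces of matrix powers\<close>

text \<open>Any family satisfying the recursion of matrix powers gives their entries. Both trace
  formulas then reduce to a recursion for sums over walks that splits off the last arc.\<close>

lemma index_pow_mat:
  fixes f :: "nat \<times> nat \<Rightarrow> 'a :: semiring_1"
  assumes "\<And>i j. i < n \<Longrightarrow> j < n \<Longrightarrow> S 0 i j = (if i = j then 1 else 0)"
    and "\<And>l i j. i < n \<Longrightarrow> j < n \<Longrightarrow> S (Suc l) i j = (\<Sum>k<n. S l i k * f (k, j))"
    and "i < n" "j < n"
  shows "(mat n n f ^\<^sub>m l) $$ (i, j) = S l i j"
  using assms(3,4)
proof (induction l arbitrary: i j)
  case 0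
  then show ?case
    by (simp add: assms(1))
next
  case (Suc l)
  then have "(mat n n f ^\<^sub>m Suc l) $$ (i, j) = (\<Sum>k<n. (mat n n f ^\<^sub>m l) $$ (i, k) * f (k, j))"
    by (simp add: times_mat_def scalar_prod_def atLeast0LessThan)
  also have "\<dots> = S (Suc l) i j"
    using Suc by (simp add: assms(2))
  finally show ?case .
qed

lemma sum_nth:
  assumes "distinct xs"
  shows "(\<Sum>k<length xs. f (xs ! k)) = sum f (set xs)"
  using assms by (intro sum.reindex_bij_betw bij_betw_nth) auto

section \<open>Powers of a weighted adjacency matrix\<close>

context fin_digraph
begin

definition walks_of_length :: "'a \<Rightarrow> nat \<Rightarrow> 'a \<Rightarrow> 'b list set" where
  "walks_of_length u l v = {p. awalk u p v \<and> length p = l}"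

lemma finite_walks_of_length: "finite (walks_of_length u l v)"
  by (rule finite_subset[OF _ finite_lists_length_eq[OF finite_arcs, of l]])
     (auto simp: walks_of_length_def awalk_def)

lemma walks_of_length_0:
  assumes "u \<in> verts G"
  shows "walks_of_length u 0 v = (if u = v then {[]} else {})"
  using assms by (auto simp: walks_of_length_def awalk_def)

lemma sum_walks_of_length_Suc:
  fixes w :: "'b \<Rightarrow> 'c :: comm_semiring_1"
  shows "(\<Sum>p\<in>walks_of_length u (Suc l) v. \<Prod>e\<leftarrow>p. w e) =
    (\<Sum>x\<in>verts G. (\<Sum>p\<in>walks_of_length u l x. \<Prod>e\<leftarrow>p. w e) * (\<Sum>e | e \<in> arcs G \<and> tail G e = x \<and> head G e = v. w e))"
proof -
  let ?W = "\<lambda>l x. \<Sum>p\<in>walks_of_length u l x. \<Prod>e\<leftarrow>p. w e"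
  have snoc: "q @ [e] \<in> walks_of_length u (Suc l) v \<longleftrightarrow>
      e \<in> arcs G \<and> head G e = v \<and> q \<in> walks_of_length u l (tail G e)" for q e v
    by (auto simp: walks_of_length_def awalk_append_iff arc_implies_awalk awalk_Cons_iff awalk_Nil_iff)
  have "?W (Suc l) v = (\<Sum>(e, q)\<in>(SIGMA e:{e \<in> arcs G. head G e = v}. walks_of_length u l (tail G e)).
                         (\<Prod>e\<leftarrow>q. w e) * w e)"
  proof (rule sum.reindex_bij_witness[of _ "\<lambda>(e, q). q @ [e]" "\<lambda>p. (last p, butlast p)"])
    fix p assume p: "p \<in> walks_of_length u (Suc l) v"
    then have eq: "butlast p @ [last p] = p"
      by (intro append_butlast_last_id) (auto simp: walks_of_length_def)
    then show "(case (last p, butlast p) of (e, q) \<Rightarrow> q @ [e]) = p"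
      by simp
    show "(last p, butlast p) \<in> (SIGMA e:{e \<in> arcs G. head G e = v}. walks_of_length u l (tail G e))"
      using p snoc[of "butlast p" "last p"] by (simp add: eq)
    have "(\<Prod>e\<leftarrow>p. w e) = (\<Prod>e\<leftarrow>butlast p @ [last p]. w e)"
      by (simp only: eq)
    then show "(case (last p, butlast p) of (e, q) \<Rightarrow> (\<Prod>e\<leftarrow>q. w e) * w e) = (\<Prod>e\<leftarrow>p. w e)"
      by simp
  qed (auto simp: snoc)
  also have "\<dots> = (\<Sum>e | e \<in> arcs G \<and> head G e = v. ?W l (tail G e) * w e)"
    by (subst sum.Sigma[symmetric]) (auto simp: finite_walks_of_length sum_distrib_right)
  \<comment> \<open>The matrix recursion sums over the penultimate vertex, so the last arcs are
    grouped by their tail.\<close>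
  also have "\<dots> = (\<Sum>x\<in>verts G. \<Sum>e | e \<in> {e \<in> arcs G. head G e = v} \<and> tail G e = x. ?W l (tail G e) * w e)"
    by (rule sum.group[symmetric]) auto
  also have "\<dots> = (\<Sum>x\<in>verts G. ?W l x * (\<Sum>e | e \<in> arcs G \<and> tail G e = x \<and> head G e = v. w e))"
    by (intro sum.cong refl) (auto simp: sum_distrib_left intro!: sum.cong)
  finally show ?thesis .
qed

text \<open>Diagonal entries collect the closed walks at one base vertex, and a closed walk is
  counted once, at the tail of its first arc. For l = 0 the trace is that of the identity, while
  closed walks are nonempty; hence \<open>l \<ge> 1\<close>.\<close>

lemma trace_pow_adjacency:
  fixes w :: "'b \<Rightarrow> 'c :: comm_semiring_1"
  assumes "distinct vs" "set vs = verts G" "l \<ge> 1"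
  shows "mat_trace (mat (length vs) (length vs)
      (\<lambda>(i, j). \<Sum>e | e \<in> arcs G \<and> tail G e = vs ! i \<and> head G e = vs ! j. w e) ^\<^sub>m l) =
    (\<Sum>p | closed_walk G p \<and> length p = l. \<Prod>e\<leftarrow>p. w e)"
proof -
  let ?C = "{p. closed_walk G p \<and> length p = l}"
  let ?S = "\<lambda>l i j. \<Sum>p\<in>walks_of_length (vs ! i) l (vs ! j). \<Prod>e\<leftarrow>p. w e"
  let ?M = "mat (length vs) (length vs) (\<lambda>(i, j). \<Sum>e | e \<in> arcs G \<and> tail G e = vs ! i \<and> head G e = vs ! j. w e)"
  have v: "vs ! i \<in> verts G" if "i < length vs" for i
    using that assms(2) nth_mem by blast
  have "(?M ^\<^sub>m l) $$ (i, j) = ?S l i j" if "i < length vs" "j < length vs" for i j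
  proof (rule index_pow_mat[OF _ _ that])
    fix i j assume "i < length vs" "j < length vs"
    then show "?S 0 i j = (if i = j then 1 else 0)"
      using assms(1) by (simp add: walks_of_length_0[OF v] nth_eq_iff_index_eq)
  next
    fix l i j
    show "?S (Suc l) i j = (\<Sum>k<length vs. ?S l i k *
        (case (k, j) of (i, j) \<Rightarrow> \<Sum>e | e \<in> arcs G \<and> tail G e = vs ! i \<and> head G e = vs ! j. w e))"
      unfolding sum_walks_of_length_Suc
      by (simp add: sum_nth[OF assms(1), symmetric] flip: assms(2))
  qed
  then have "mat_trace (?M ^\<^sub>m l) = (\<Sum>v\<in>verts G. \<Sum>p\<in>walks_of_length v l v. \<Prod>e\<leftarrow>p. w e)"
    by (simp add: mat_trace_def sum_nth[OF assms(1), symmetric] flip: assms(2))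
  also have "\<dots> = (\<Sum>v\<in>verts G. \<Sum>p | p \<in> ?C \<and> tail G (hd p) = v. \<Prod>e\<leftarrow>p. w e)"
  proof (rule sum.cong[OF refl])
    fix v assume "v \<in> verts G"
    have "p \<in> walks_of_length v l v \<longleftrightarrow> p \<in> ?C \<and> tail G (hd p) = v" for p
      using assms(3) by (cases p) (auto simp: walks_of_length_def closed_walk_def awalk_def)
    then have "walks_of_length v l v = {p \<in> ?C. tail G (hd p) = v}"
      by blast
    then show "(\<Sum>p\<in>walks_of_length v l v. \<Prod>e\<leftarrow>p. w e) = (\<Sum>p | p \<in> ?C \<and> tail G (hd p) = v. \<Prod>e\<leftarrow>p. w e)"
      by simp
  qed
  also have "\<dots> = (\<Sum>p\<in>?C. \<Prod>e\<leftarrow>p. w e)"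
  proof (rule sum.group)
    show "finite ?C"
      by (rule finite_subset[OF _ finite_lists_length_eq[OF finite_arcs, of l]])
         (auto simp: closed_walk_def awalk_def)
    show "(\<lambda>p. tail G (hd p)) ` ?C \<subseteq> verts G"
      by (auto simp: closed_walk_def awalk_def cas_simp)
  qed simp
  finally show ?thesis .
qed

end

text \<open>Repeating the head at the end closes the sequence up. For circuits, the absence of a
  tail becomes one more admissible transition, from the last arc to the first.\<close>

definition cyclically :: "('a \<Rightarrow> 'a \<Rightarrow> bool) \<Rightarrow> 'a list \<Rightarrow> bool" where
  "cyclically R p \<longleftrightarrow> p \<noteq> [] \<and> successively R (p @ [hd p])"

lemma cyclically_iff: "cyclically R p \<longleftrightarrow> p \<noteq> [] \<and> successively R p \<and> R (last p) (hd p)"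
  by (auto simp: cyclically_def successively_append_iff)

lemma cyclically_map_if:
  assumes "cyclically R p" "\<And>x y. x \<in> set p \<Longrightarrow> y \<in> set p \<Longrightarrow> R x y \<Longrightarrow> Q (f x) (f y)"
  shows "cyclically Q (map f p)"
  using assms by (auto simp: cyclically_iff successively_map hd_map last_map elim: successively_mono)

text \<open>Each transition carries the weight of the element it leaves, so a chain of l transitions
  from x to y collects the weights of all its entries except y. On the diagonal y equals x, and
  every entry of the cyclic sequence is weighted once.\<close>

lemma trace_pow_relation:
  fixes w :: "'e \<Rightarrow> 'c :: comm_semiring_1"
  assumes "distinct es" "l \<ge> 1"
  shows "mat_trace (mat (length es) (length es) (\<lambda>(i, j). if R (es ! i) (es ! j) then w (es ! i) else 0) ^\<^sub>m l) =
    (\<Sum>p | set p \<subseteq> set es \<and> cyclically R p \<and> length p = l. \<Prod>e\<leftarrow>p. w e)"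
proof -
  \<comment> \<open>The end point y is appended only to test the last transition and is not part of
    the list. Taking the head of \<open>p @ [y]\<close> covers length 0, where the list is empty and
    x must be y.\<close>
  define P where "P x l y = {p. set p \<subseteq> set es \<and> length p = l \<and> hd (p @ [y]) = x \<and> successively R (p @ [y])}" for x l y
  let ?C = "{p. set p \<subseteq> set es \<and> cyclically R p \<and> length p = l}"
  let ?S = "\<lambda>l i j. \<Sum>p\<in>P (es ! i) l (es ! j). \<Prod>e\<leftarrow>p. w e"
  let ?M = "mat (length es) (length es) (\<lambda>(i, j). if R (es ! i) (es ! j) then w (es ! i) else 0)"
  have fin: "finite (P x l y)" for x l y
    by (rule finite_subset[OF _ finite_lists_length_eq[of "set es" l]]) (auto simp: P_def)
  have snoc: "q @ [x] \<in> P u (Suc l) y \<longleftrightarrow> x \<in> set es \<and> R x y \<and> q \<in> P u l x" for q x u l y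
  proof -
    have "hd (q @ [x, y]) = hd (q @ [x])"
      by (cases q) auto
    then show ?thesis
      by (auto simp: P_def successively_append_iff)
  qed
  have Suc: "(\<Sum>p\<in>P u (Suc l) y. \<Prod>e\<leftarrow>p. w e) =
      (\<Sum>x\<in>set es. (\<Sum>p\<in>P u l x. \<Prod>e\<leftarrow>p. w e) * (if R x y then w x else 0))" for u l y
  proof -
    have "(\<Sum>p\<in>P u (Suc l) y. \<Prod>e\<leftarrow>p. w e) =
        (\<Sum>(x, q)\<in>(SIGMA x:{x \<in> set es. R x y}. P u l x). (\<Prod>e\<leftarrow>q. w e) * w x)"
    proof (rule sum.reindex_bij_witness[of _ "\<lambda>(x, q). q @ [x]" "\<lambda>p. (last p, butlast p)"])
      fix p assume p: "p \<in> P u (Suc l) y"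
      then have eq: "butlast p @ [last p] = p"
        by (intro append_butlast_last_id) (auto simp: P_def)
      then show "(case (last p, butlast p) of (x, q) \<Rightarrow> q @ [x]) = p"
        by simp
      show "(last p, butlast p) \<in> (SIGMA x:{x \<in> set es. R x y}. P u l x)"
        using p snoc[of "butlast p" "last p"] by (simp add: eq)
      have "(\<Prod>e\<leftarrow>p. w e) = (\<Prod>e\<leftarrow>butlast p @ [last p]. w e)"
        by (simp only: eq)
      then show "(case (last p, butlast p) of (x, q) \<Rightarrow> (\<Prod>e\<leftarrow>q. w e) * w x) = (\<Prod>e\<leftarrow>p. w e)"
        by simp
    qed (auto simp: snoc)
    also have "\<dots> = (\<Sum>x | x \<in> set es \<and> R x y. (\<Sum>p\<in>P u l x. \<Prod>e\<leftarrow>p. w e) * w x)"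
      by (simp add: sum.Sigma[symmetric] fin sum_distrib_right)
    also have "\<dots> = (\<Sum>x\<in>set es. (\<Sum>p\<in>P u l x. \<Prod>e\<leftarrow>p. w e) * (if R x y then w x else 0))"
      by (simp add: sum.inter_filter if_distrib cong: if_cong)
    finally show ?thesis .
  qed
  have "(?M ^\<^sub>m l) $$ (i, j) = ?S l i j" if "i < length es" "j < length es" for i j
  proof (rule index_pow_mat[OF _ _ that])
    fix i j assume ij: "i < length es" "j < length es"
    have "P (es ! i) 0 (es ! j) = (if i = j then {[]} else {})"
      using ij assms(1) by (auto simp: P_def nth_eq_iff_index_eq)
    then show "?S 0 i j = (if i = j then 1 else 0)"
      by simp
  next
    fix l i j
    show "?S (Suc l) i j = (\<Sum>k<length es. ?S l i k *
        (case (k, j) of (i, j) \<Rightarrow> if R (es ! i) (es ! j) then w (es ! i) else 0))"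
      unfolding Suc by (simp add: sum_nth[OF assms(1), symmetric])
  qed
  then have "mat_trace (?M ^\<^sub>m l) = (\<Sum>x\<in>set es. \<Sum>p\<in>P x l x. \<Prod>e\<leftarrow>p. w e)"
    by (simp add: mat_trace_def sum_nth[OF assms(1), symmetric])
  also have "\<dots> = (\<Sum>x\<in>set es. \<Sum>p | p \<in> ?C \<and> hd p = x. \<Prod>e\<leftarrow>p. w e)"
  proof (rule sum.cong[OF refl])
    fix x
    have "P x l x = {p \<in> ?C. hd p = x}"
      using assms(2) by (auto simp: P_def cyclically_def hd_append split: if_splits)
    then show "(\<Sum>p\<in>P x l x. \<Prod>e\<leftarrow>p. w e) = (\<Sum>p | p \<in> ?C \<and> hd p = x. \<Prod>e\<leftarrow>p. w e)"
      by simp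
  qed
  also have "\<dots> = (\<Sum>p\<in>?C. \<Prod>e\<leftarrow>p. w e)"
  proof (rule sum.group)
    show "finite ?C"
      by (rule finite_subset[OF _ finite_lists_length_eq[of "set es" l]]) auto
    show "hd ` ?C \<subseteq> set es"
      by (auto simp: cyclically_def)
  qed simp
  finally show ?thesis .
qed

section \<open>Closed walks and circuits as cyclic sequences\<close>

lemma (in pre_digraph) cas_Cons_iff_successively:
  "cas u (e # p) v \<longleftrightarrow>
     tail G e = u \<and> successively (\<lambda>e e'. head G e = tail G e') (e # p) \<and> head G (last (e # p)) = v"
proof (induction p arbitrary: u e)
  case (Cons e' p)
  define R where "R = (\<lambda>e e'. head G e = tail G e')"
  have "cas u (e # e' # p) v \<longleftrightarrow> tail G e = u \<and> cas (head G e) (e' # p) v"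
    by (simp only: cas.simps(2))
  also have "\<dots> \<longleftrightarrow> tail G e = u \<and> R e e' \<and> successively R (e' # p) \<and> head G (last (e' # p)) = v"
    unfolding Cons.IH R_def by (simp only: eq_commute[of "tail G e'"])
  also have "\<dots> \<longleftrightarrow> tail G e = u \<and> successively R (e # e' # p) \<and> head G (last (e # e' # p)) = v"
    by simp
  finally show ?case
    unfolding R_def .
qed simp

context multigraph
begin

lemma closed_walk_iff:
  "closed_walk G p \<longleftrightarrow> set p \<subseteq> arcs G \<and> cyclically (\<lambda>e e'. head G e = tail G e') p"
  by (cases p) (auto simp: closed_walk_def awalk_def cas_Cons_iff_successively cyclically_iff simp del: cas.simps)

lemma circuit_iff: "circuit G arev p \<longleftrightarrow> set p \<subseteq> arcs G \<and> cyclically (feeds_into G arev) p"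
proof -
  \<comment> \<open>Since reversal is an involution, the tail condition is the backtracking
    condition for the transition that closes the sequence.\<close>
  have "last p \<noteq> arev (hd p) \<longleftrightarrow> hd p \<noteq> arev (last p)"
    by (metis arev_arev)
  then show ?thesis
    by (auto simp: circuit_def closed_walk_iff cyclically_iff feeds_into_def successively_conv_nth)
qed

end

section \<open>Traces as character sums over walks, and their invariance\<close>

context oriented_multigraph
begin

lemma trace_adj_mat:
  assumes "distinct vs" "set vs = verts G" "l \<ge> 1"
  shows "mat_trace (adj_mat G arev Eo vs t \<gamma> ^\<^sub>m l) =
    (\<Sum>p | closed_walk G p \<and> length p = l. \<Prod>e\<leftarrow>p. chi t arev Eo \<gamma> e)"
  unfolding adj_mat_def by (rule trace_pow_adjacency[OF assms])

lemma trace_edge_adj_mat: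
  assumes "distinct es" "set es = arcs G" "l \<ge> 1"
  shows "mat_trace (edge_adj_mat G arev Eo es t \<gamma> ^\<^sub>m l) =
    (\<Sum>p | circuit G arev p \<and> length p = l. \<Prod>e\<leftarrow>p. chi t arev Eo \<gamma> e)"
  unfolding edge_adj_mat_def circuit_iff trace_pow_relation[OF assms(1,3)] assms(2) by (simp add: conj_assoc)

lemma closed_walk_map_aut:
  assumes "is_aut G arev \<tau>" "closed_walk G p"
  shows "closed_walk G (map (on_arcs \<tau>) p)"
  using assms unfolding closed_walk_iff
  by (auto intro!: cyclically_map_if aut_arc simp: aut_head aut_tail subset_iff)

lemma circuit_map_aut:
  assumes \<tau>: "is_aut G arev \<tau>" and p: "circuit G arev p"
  shows "circuit G arev (map (on_arcs \<tau>) p)"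
proof -
  have "feeds_into G arev (on_arcs \<tau> e) (on_arcs \<tau> e')"
    if "e \<in> arcs G" "e' \<in> arcs G" "feeds_into G arev e e'" for e e'
    using that by (simp add: feeds_into_def aut_head[OF \<tau>] aut_tail[OF \<tau>] aut_inj[OF \<tau>] flip: aut_arev[OF \<tau>])
  with p show ?thesis
    unfolding circuit_iff by (auto intro!: cyclically_map_if aut_arc[OF \<tau>])
qed

text \<open>The automorphism maps the finite set C injectively into itself, hence permutes it.
  Reindexing by it cancels its action on \<gamma>, since the transported character at the image of
  an arc is the old one at the arc.\<close>

lemma sum_chi_act:
  assumes \<tau>: "is_aut G arev \<tau>" and C: "finite C" "\<And>p. p \<in> C \<Longrightarrow> set p \<subseteq> arcs G"
    and map: "\<And>p. p \<in> C \<Longrightarrow> map (on_arcs \<tau>) p \<in> C"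
  shows "(\<Sum>p\<in>C. \<Prod>e\<leftarrow>p. chi t arev Eo (act t arev Eo \<tau> \<gamma>) e) = (\<Sum>p\<in>C. \<Prod>e\<leftarrow>p. chi t arev Eo \<gamma> e)"
proof -
  have inj: "inj_on (map (on_arcs \<tau>)) C"
    using aut_inj[OF \<tau>] by (intro inj_on_subset[OF inj_mapI]) (auto intro: injI)
  then have "map (on_arcs \<tau>) ` C = C"
    using map by (intro endo_inj_surj[OF C(1)]) auto
  with inj have "bij_betw (map (on_arcs \<tau>)) C C"
    by (simp add: bij_betw_def)
  then have "(\<Sum>p\<in>C. \<Prod>e\<leftarrow>p. chi t arev Eo (act t arev Eo \<tau> \<gamma>) e) =
      (\<Sum>p\<in>C. \<Prod>e\<leftarrow>map (on_arcs \<tau>) p. chi t arev Eo (act t arev Eo \<tau> \<gamma>) e)"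
    by (rule sum.reindex_bij_betw[symmetric])
  also have "\<dots> = (\<Sum>p\<in>C. \<Prod>e\<leftarrow>p. chi t arev Eo \<gamma> e)"
  proof (rule sum.cong[OF refl])
    fix p assume "p \<in> C"
    then have "map (\<lambda>e. chi t arev Eo (act t arev Eo \<tau> \<gamma>) (on_arcs \<tau> e)) p = map (chi t arev Eo \<gamma>) p"
      using C(2) by (intro map_cong refl chi_act[OF \<tau>]) auto
    then show "(\<Prod>e\<leftarrow>map (on_arcs \<tau>) p. chi t arev Eo (act t arev Eo \<tau> \<gamma>) e) = (\<Prod>e\<leftarrow>p. chi t arev Eo \<gamma> e)"
      by (simp only: map_map comp_def)
  qed
  finally show ?thesis .
qed

text \<open>The common form of both counts: all it needs of the class P of walks is stability under
  automorphisms, and of the trace that it is the character sum over P.\<close>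

lemma card_walks_orbs:
  fixes tr :: "('e \<Rightarrow> int) \<Rightarrow> complex"
  assumes H: "subgroup H (Aut G arev)" and F: "F \<subseteq> Eo" and \<alpha>: "\<alpha> \<in> chains t F"
    and rep: "\<And>c. c \<in> orbs t arev Eo H (chains_on t Eo F) \<Longrightarrow> rep c \<in> c"
    and P: "\<And>p. P p \<Longrightarrow> set p \<subseteq> arcs G" "\<And>p \<tau>. P p \<Longrightarrow> is_aut G arev \<tau> \<Longrightarrow> P (map (on_arcs \<tau>) p)"
    and tr: "\<And>\<gamma>. tr \<gamma> = (\<Sum>p | P p \<and> length p = l. \<Prod>e\<leftarrow>p. chi t arev Eo \<gamma> e)"
  shows "of_nat (card {p. P p \<and> length p = l \<and> restr F (walk_ab t arev Eo p) = \<alpha>}) =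
    1 / of_nat t ^ card F * (\<Sum>c\<in>orbs t arev Eo H (chains_on t Eo F).
      (\<Sum>\<gamma>'\<in>c. root_of_unity t powi (- pairing t Eo \<gamma>' \<alpha>)) * tr (rep c))"
proof -
  let ?C = "{p. P p \<and> length p = l}"
  have fin: "finite ?C"
    by (rule finite_subset[OF _ finite_lists_length_eq[OF finite_arcs, of l]]) (auto dest: P(1))
  have aut: "is_aut G arev \<tau>" if "\<tau> \<in> H" for \<tau>
    using subgroup.subset[OF H] that by (auto simp: Aut_def)
  have "{p. P p \<and> length p = l \<and> restr F (walk_ab t arev Eo p) = \<alpha>} = {p \<in> ?C. restr F (walk_ab t arev Eo p) = \<alpha>}"
    by auto
  then have "of_nat (card {p. P p \<and> length p = l \<and> restr F (walk_ab t arev Eo p) = \<alpha>}) =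
    1 / of_nat t ^ card F * (\<Sum>\<gamma>\<in>chains_on t Eo F. root_of_unity t powi (- pairing t Eo \<gamma> \<alpha>) * tr \<gamma>)"
    using card_walks_with_restriction[OF fin _ F \<alpha>] P(1) by (simp add: tr chains_on_eq[OF F])
  also have "(\<Sum>\<gamma>\<in>chains_on t Eo F. root_of_unity t powi (- pairing t Eo \<gamma> \<alpha>) * tr \<gamma>) =
    (\<Sum>c\<in>orbs t arev Eo H (chains_on t Eo F).
      (\<Sum>\<gamma>'\<in>c. root_of_unity t powi (- pairing t Eo \<gamma>' \<alpha>)) * tr (rep c))"
  proof (rule sum_orbs[OF H _ _ rep])
    show "finite (chains_on t Eo F)"
      using finite_chains[OF t_pos finite_subset[OF F finite_Eo]] by (simp add: chains_on_eq[OF F])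
    show "chains_on t Eo F \<subseteq> chains t Eo"
      by (auto simp: chains_on_def)
    show "tr (act t arev Eo \<tau> \<gamma>) = tr \<gamma>" if "\<tau> \<in> H" for \<tau> \<gamma>
      unfolding tr using aut[OF that] P by (intro sum_chi_act fin) auto
  qed
  finally show ?thesis .
qed

lemma num_closed_walks_eq:
  assumes "subgroup H (Aut G arev)" "F \<subseteq> Eo" "\<alpha> \<in> chains t F"
    and "\<And>c. c \<in> orbs t arev Eo H (chains_on t Eo F) \<Longrightarrow> rep c \<in> c"
    and "distinct vs" "set vs = verts G" "l \<ge> 1"
  shows "of_nat (num_closed_walks G arev Eo t F \<alpha> l) =
    1 / of_nat t ^ card F * (\<Sum>c\<in>orbs t arev Eo H (chains_on t Eo F).
      (\<Sum>\<gamma>'\<in>c. root_of_unity t powi (- pairing t Eo \<gamma>' \<alpha>)) * mat_trace (adj_mat G arev Eo vs t (rep c) ^\<^sub>m l))"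
  unfolding num_closed_walks_def
  by (rule card_walks_orbs[where tr = "\<lambda>\<gamma>. mat_trace (adj_mat G arev Eo vs t \<gamma> ^\<^sub>m l)"])
     (use assms in \<open>simp_all add: trace_adj_mat closed_walk_map_aut, simp add: closed_walk_iff\<close>)

lemma num_circuits_eq:
  assumes "subgroup H (Aut G arev)" "F \<subseteq> Eo" "\<alpha> \<in> chains t F"
    and "\<And>c. c \<in> orbs t arev Eo H (chains_on t Eo F) \<Longrightarrow> rep c \<in> c"
    and "distinct es" "set es = arcs G" "l \<ge> 1"
  shows "of_nat (num_circuits G arev Eo t F \<alpha> l) =
    1 / of_nat t ^ card F * (\<Sum>c\<in>orbs t arev Eo H (chains_on t Eo F).
      (\<Sum>\<gamma>'\<in>c. root_of_unity t powi (- pairing t Eo \<gamma>' \<alpha>)) * mat_trace (edge_adj_mat G arev Eo es t (rep c) ^\<^sub>m l))"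
  unfolding num_circuits_def
  by (rule card_walks_orbs[where tr = "\<lambda>\<gamma>. mat_trace (edge_adj_mat G arev Eo es t \<gamma> ^\<^sub>m l)"])
     (use assms in \<open>simp_all add: trace_edge_adj_mat circuit_map_aut, simp add: circuit_iff\<close>)

end

section \<open>Cycles in graphs without leaves\<close>

lemma (in pre_digraph) cas_map_upt:
  assumes "\<And>n. tail G (f (Suc n)) = head G (f n)" "i \<le> j"
  shows "cas (tail G (f i)) (map f [i..<j]) (tail G (f j))"
  using assms(2)
proof (induction rule: inc_induct)
  case (step n)
  then show ?case
    by (simp add: upt_conv_Cons assms(1))
qed simp

context multigraph
begin

text \<open>
  Walk on without backtracking until a vertex repeats for the first time; the minimality of the
  repetition excludes a tail as well.
\<close>
lemma cycle_circuit_if_no_leaf: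
  assumes sub: "subgraph T G" and S: "S \<subseteq> arcs T" "e\<^sub>0 \<in> S"
    and ext: "\<And>e. e \<in> S \<Longrightarrow> \<exists>e'\<in>S. feeds_into G arev e e'"
  shows "\<exists>p. pre_digraph.cycle T p \<and> circuit T arev p"
proof -
  interpret T: wf_digraph T
    using sub by (simp add: subgraph_def)
  have T: "tail T = tail G" "head T = head G" "arcs T \<subseteq> arcs G"
    using sub by (auto simp: subgraph_def compatible_def)
  obtain next_arc where next_arc: "\<And>e. e \<in> S \<Longrightarrow> next_arc e \<in> S \<and> feeds_into G arev e (next_arc e)"
    using ext by metis
  define f where "f n = (next_arc ^^ n) e\<^sub>0" for n
  have fS: "f n \<in> S" for n
    using S(2) next_arc by (induction n) (auto simp: f_def)
  then have fT: "f n \<in> arcs T" and fG: "f n \<in> arcs G" for n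
    using S(1) T(3) by blast+
  have feeds: "feeds_into G arev (f n) (f (Suc n))" for n
    using next_arc[OF fS[of n]] by (simp add: f_def)
  then have succ: "tail G (f (Suc n)) = head G (f n)" and noback: "f (Suc n) \<noteq> arev (f n)" for n
    by (auto simp: feeds_into_def)
  let ?x = "\<lambda>n. tail G (f n)"
  have "finite (range ?x)"
    by (rule finite_subset[OF _ finite_verts]) (use fG in auto)
  then have "\<not> inj ?x"
    using finite_imageD infinite_UNIV_nat by blast
  then have "\<exists>j. \<exists>i<j. ?x i = ?x j"
    by (metis injI linorder_neqE_nat)
  then obtain j where j: "\<exists>i<j. ?x i = ?x j" and least: "\<And>m. m < j \<Longrightarrow> \<not> (\<exists>i<m. ?x i = ?x m)"
    using exists_least_iff[of "\<lambda>j. \<exists>i<j. ?x i = ?x j"] by blast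
  from j obtain i where i: "i < j" "?x i = ?x j"
    by blast
  have inj: "a = b" if "a < j" "b < j" "?x a = ?x b" for a b
    using least[OF that(1)] least[OF that(2)] that(3) by (metis linorder_neqE_nat)
  let ?p = "map f [i..<j]"
  have ne: "?p \<noteq> []"
    using i(1) by simp
  have last: "last ?p = f (j - 1)" and hd: "hd ?p = f i"
    using i(1) by (simp_all add: last_map hd_map)
  have awalk: "T.awalk (?x i) ?p (?x i)"
    using T.cas_map_upt[of f i j] i succ fT T.tail_in_verts[OF fT] by (auto simp: T.awalk_def T)
  have "head G (f (j - 1)) = ?x j"
    using succ[of "j - 1"] i(1) by simp
  then have "T.awalk_verts (?x i) ?p = map ?x [i..<j] @ [?x j]"
    using ne last by (simp add: T.awalk_verts_conv T comp_def del: map_is_Nil_conv)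
  also have "\<dots> = map ?x [i..<Suc j]"
    using i(1) by simp
  finally have verts: "tl (T.awalk_verts (?x i) ?p) = map ?x [Suc i..<Suc j]"
    using i(1) by (simp add: upt_conv_Cons del: upt_Suc)
  \<comment> \<open>The base vertex occurs at both ends, and \<open>cycle\<close> asks for
    distinctness without the first entry. The only index beyond the minimality argument is j, whose
    vertex is that of index i.\<close>
  have "inj_on ?x {Suc i..<Suc j}"
  proof (rule linorder_inj_onI)
    fix a b assume ab: "a < b" "a \<in> {Suc i..<Suc j}" "b \<in> {Suc i..<Suc j}"
    show "?x a \<noteq> ?x b"
    proof (cases "b = j")
      case True
      with ab i inj[of i a] show ?thesis
        by auto
    next
      case False
      with ab inj[of a b] show ?thesis
        by auto
    qed
  qed auto
  then have "T.cycle ?p"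
    unfolding T.cycle_def using awalk ne verts by (intro exI[of _ "?x i"]) (simp add: distinct_map del: upt_Suc)
  moreover have "circuit T arev ?p"
    unfolding circuit_def
  proof (intro conjI allI impI)
    show "closed_walk T ?p"
      using awalk ne by (auto simp: closed_walk_def)
    show "?p ! Suc k \<noteq> arev (?p ! k)" if "Suc k < length ?p" for k
      using noback[of "i + k"] that by simp
    show "last ?p \<noteq> arev (hd ?p)"
    proof
      assume "last ?p = arev (hd ?p)"
      \<comment> \<open>A tail would make the last arc start where arc i ends, so by injectivity it
        is arc i + 1, which would backtrack. The case of a single arc is excluded because no arc is
        its own reverse.\<close>
      then have eq: "f (j - 1) = arev (f i)"
        by (simp only: last hd)
      then have "j - 1 \<noteq> i"
        using arev_neq[OF fG] by metis
      then have "Suc i < j"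
        using i(1) by simp
      moreover have "?x (j - 1) = ?x (Suc i)"
        using eq succ[of i] tail_arev[OF fG] by metis
      ultimately have "j - 1 = Suc i"
        using inj[of "j - 1" "Suc i"] by simp
      with eq noback[of i] show False
        by simp
    qed
  qed
  ultimately show ?thesis
    by blast
qed

end

section \<open>Homology and spanning trees\<close>

text \<open>Outflow minus inflow at v, the usual boundary up to sign. It stays integral, so that
  telescoping and summation over the vertices give exact zeros; congruences enter only
  afterwards.\<close>

definition boundary :: "('v, 'e) pre_digraph \<Rightarrow> 'e set \<Rightarrow> ('e \<Rightarrow> int) \<Rightarrow> 'v \<Rightarrow> int" where
  "boundary G Eo c v = (\<Sum>e\<in>Eo. c e * (of_bool (tail G e = v) - of_bool (head G e = v)))"

lemma boundary_diff: "boundary G Eo (\<lambda>e. a e - b e) v = boundary G Eo a v - boundary G Eo b v"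
  by (simp add: boundary_def left_diff_distrib sum_subtractf)

lemma (in pre_digraph) cas_sum_ends:
  "cas u p w \<Longrightarrow> (\<Sum>e\<leftarrow>p. of_bool (tail G e = v) - of_bool (head G e = v)) = (of_bool (u = v) - of_bool (w = v) :: int)"
  by (induction p arbitrary: u) auto

context oriented_multigraph
begin

lemma H1_iff: "c \<in> H1 G t Eo \<longleftrightarrow> c \<in> chains t Eo \<and> (\<forall>v\<in>verts G. int t dvd boundary G Eo c v)"
proof -
  have "(\<Sum>e | e \<in> Eo \<and> P e. c e) = (\<Sum>e\<in>Eo. c e * of_bool (P e))" for P
    using finite_Eo by (simp add: of_bool_def sum.inter_filter if_distrib cong: if_cong)
  then show ?thesis
    by (simp add: H1_def mod_eq_dvd_iff boundary_def right_diff_distrib sum_subtractf)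
qed

lemma boundary_reduce: "boundary G Eo (reduce t c) v mod int t = boundary G Eo c v mod int t"
proof -
  let ?b = "\<lambda>e. of_bool (tail G e = v) - of_bool (head G e = v) :: int"
  have "boundary G Eo (reduce t c) v mod int t = (\<Sum>e\<in>Eo. (c e mod int t) * ?b e mod int t) mod int t"
    by (simp only: boundary_def reduce_def mod_sum_eq)
  also have "\<dots> = boundary G Eo c v mod int t"
    by (simp only: boundary_def mod_mult_left_eq mod_sum_eq)
  finally show ?thesis .
qed

text \<open>The unreduced sum of the arcs of a closed walk has boundary exactly 0 by telescoping,
  and reducing the coefficients preserves boundaries modulo t.\<close>

lemma walk_ab_in_H1:
  assumes "closed_walk G p"
  shows "walk_ab t arev Eo p \<in> H1 G t Eo"
proof -
  obtain u where u: "awalk u p u"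
    using assms by (auto simp: closed_walk_def)
  then have p: "set p \<subseteq> arcs G"
    by (auto simp: awalk_def)
  have "boundary G Eo (\<lambda>x. \<Sum>e\<leftarrow>p. arc_chain arev Eo e x) v = 0" for v
  proof -
    let ?b = "\<lambda>e. of_bool (tail G e = v) - of_bool (head G e = v) :: int"
    have "boundary G Eo (\<lambda>x. \<Sum>e\<leftarrow>p. arc_chain arev Eo e x) v = (\<Sum>e\<leftarrow>p. \<Sum>x\<in>Eo. arc_chain arev Eo e x * ?b x)"
      unfolding boundary_def by (induction p) (simp_all add: distrib_right sum.distrib)
    also have "\<dots> = (\<Sum>e\<leftarrow>p. ?b e)"
    proof (intro arg_cong[of _ _ sum_list] map_cong refl)
      fix e assume "e \<in> set p"
      with p have "e \<in> arcs G"
        by blast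
      \<comment> \<open>The evaluation of \<open>arc_chain\<close> is applied to \<open>?b\<close>
        in the role of the chain: reversal exchanges tail and head, so \<open>?b\<close> is its own
        antisymmetric extension.\<close>
      then show "(\<Sum>x\<in>Eo. arc_chain arev Eo e x * ?b x) = ?b e"
        using sum_arc_chain[of e ?b] by (simp add: coeff_at_def mult.commute)
    qed
    also have "\<dots> = 0"
      using u cas_sum_ends[of u p u v] by (simp add: awalk_def)
    finally show ?thesis .
  qed
  then show ?thesis
    unfolding H1_iff walk_ab_def dvd_eq_mod_eq_0 boundary_reduce
    using walk_ab_chain[of p] by (simp add: walk_ab_def)
qed

text \<open>This makes a leaf of the support of a cycle visible as a sum with a single nonzero term.\<close>
lemma boundary_eq_sum_out_arcs:
  "boundary G Eo c v = (\<Sum>e | e \<in> arcs G \<and> tail G e = v. coeff_at arev Eo c e)"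
proof -
  let ?O = "{e \<in> arcs G. tail G e = v}"
  have fin: "finite ?O"
    by simp
  have neg: "(\<Sum>e\<in>?O - Eo. coeff_at arev Eo c e) = (\<Sum>e | e \<in> Eo \<and> head G e = v. - c e)"
    by (rule sum.reindex_bij_witness[of _ arev arev])
       (auto simp: coeff_at_def arev_in_Eo_iff Eo_arc)
  have pos: "(\<Sum>e\<in>?O \<inter> Eo. coeff_at arev Eo c e) = (\<Sum>e | e \<in> Eo \<and> tail G e = v. c e)"
    by (intro sum.cong) (auto simp: coeff_at_def Eo_arc)
  have sel: "(\<Sum>e\<in>Eo. c e * of_bool (P e)) = (\<Sum>e | e \<in> Eo \<and> P e. c e)" for P
    using finite_Eo by (simp add: of_bool_def sum.inter_filter if_distrib cong: if_cong)
  have "(\<Sum>e\<in>?O. coeff_at arev Eo c e) = (\<Sum>e\<in>?O \<inter> Eo. coeff_at arev Eo c e) + (\<Sum>e\<in>?O - Eo. coeff_at arev Eo c e)"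
    using sum.Int_Diff[OF fin] .
  then show ?thesis
    by (simp add: neg pos boundary_def right_diff_distrib sum_subtractf sel sum_negf)
qed

lemma sum_boundary: "(\<Sum>v\<in>verts G. boundary G Eo c v) = 0"
proof -
  have "(\<Sum>v\<in>verts G. boundary G Eo c v) =
      (\<Sum>e\<in>Eo. \<Sum>v\<in>verts G. c e * (of_bool (tail G e = v) - of_bool (head G e = v)))"
    unfolding boundary_def by (rule sum.swap)
  also have "\<dots> = (\<Sum>e\<in>Eo. 0)"
    by (intro sum.cong refl)
       (simp add: sum_distrib_left[symmetric] sum_subtractf of_bool_def Eo_arc)
  finally show ?thesis
    by simp
qed

text \<open>Arcs with coefficient nonzero modulo t lie in the tree. At the head of such an arc the
  outgoing coefficients sum to 0 modulo t while the reversed arc contributes a nonzero term, so a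
  second nonzero arc leaves. One can thus walk on forever without backtracking, which yields a cycle
  in the tree.\<close>

lemma cycle_on_tree_vanishes:
  assumes T: "spanning_tree_of T G arev"
    and supp: "\<And>e. e \<in> Eo - arcs T \<Longrightarrow> int t dvd c e"
    and bd: "\<And>v. v \<in> verts G \<Longrightarrow> int t dvd boundary G Eo c v"
    and e: "e \<in> Eo"
  shows "int t dvd c e"
proof (rule ccontr)
  assume not_dvd: "\<not> int t dvd c e"
  let ?D = "coeff_at arev Eo c"
  have sub: "subgraph T G" and T_arev: "\<And>e. e \<in> arcs T \<Longrightarrow> arev e \<in> arcs T"
    using T by (auto simp: spanning_tree_of_def spanning_def)
  have in_T: "e \<in> arcs T" if "e \<in> arcs G" "\<not> int t dvd ?D e" for e
  proof (cases "e \<in> Eo")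
    case True
    with that supp[of e] show ?thesis
      by (auto simp: coeff_at_def)
  next
    case False
    with that supp[of "arev e"] have "arev e \<in> arcs T"
      by (auto simp: coeff_at_def arev_in_Eo_iff)
    then show ?thesis
      using T_arev by force
  qed
  define S where "S = {e \<in> arcs G. \<not> int t dvd ?D e}"
  have "\<exists>p. pre_digraph.cycle T p \<and> circuit T arev p"
  proof (rule cycle_circuit_if_no_leaf[OF sub])
    show "S \<subseteq> arcs T"
      using in_T by (auto simp: S_def)
    show "e \<in> S"
      using e not_dvd by (simp add: S_def Eo_arc coeff_at_def)
    fix e assume "e \<in> S"
    then have e: "e \<in> arcs G" "\<not> int t dvd ?D e"
      by (auto simp: S_def)
    show "\<exists>e'\<in>S. feeds_into G arev e e'"
    proof (rule ccontr)
      assume *: "\<not> (\<exists>e'\<in>S. feeds_into G arev e e')"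
      let ?O = "{e' \<in> arcs G. tail G e' = head G e}"
      have "int t dvd (\<Sum>e'\<in>?O - {arev e}. ?D e')"
        by (rule dvd_sum) (use * in \<open>auto simp: S_def feeds_into_def\<close>)
      moreover have "(\<Sum>e'\<in>?O. ?D e') = ?D (arev e) + (\<Sum>e'\<in>?O - {arev e}. ?D e')"
        using e(1) by (intro sum.remove) auto
      moreover have "int t dvd (\<Sum>e'\<in>?O. ?D e')"
        using bd[of "head G e"] e(1) by (simp add: boundary_eq_sum_out_arcs)
      ultimately have "int t dvd ?D (arev e)"
        by (simp add: dvd_add_left_iff)
      with e show False
        by (simp add: coeff_at_arev)
    qed
  qed
  with T show False
    by (auto simp: spanning_tree_of_def)
qed

lemma H1_eqI:
  assumes T: "spanning_tree_of T G arev" and ab: "a \<in> H1 G t Eo" "b \<in> H1 G t Eo"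
    and eq: "\<And>e. e \<in> Eo - arcs T \<Longrightarrow> a e = b e"
  shows "a = b"
proof (rule chains_eqI)
  show "a \<in> chains t Eo" "b \<in> chains t Eo"
    using ab by (auto simp: H1_iff)
  fix e assume "e \<in> Eo"
  have "int t dvd a e - b e"
    by (rule cycle_on_tree_vanishes[OF T _ _ \<open>e \<in> Eo\<close>])
       (use eq ab in \<open>auto simp: boundary_diff H1_iff\<close>)
  then show "a e mod int t = b e mod int t"
    by (simp add: mod_eq_dvd_iff)
qed

text \<open>A vertex function with zero coboundary on the tree is constant modulo t, by induction
  along a path in the tree; arcs traversed against the orientation are handled by their reverses.
  This is the injectivity needed for one of the two bounds on the number of tree edges.\<close>

lemma spanning_tree_path_congruence:
  assumes T: "spanning_tree_of T G arev"
    and h: "\<And>e. e \<in> Eo \<inter> arcs T \<Longrightarrow> h (tail G e) mod int t = h (head G e) mod int t"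
    and uv: "u \<in> verts G" "v \<in> verts G"
  shows "h u mod int t = (h v :: int) mod int t"
proof -
  have sub: "subgraph T G" and T_arev: "\<And>e. e \<in> arcs T \<Longrightarrow> arev e \<in> arcs T"
    and conn: "Digraph_Component.connected T" and verts: "verts T = verts G"
    using T by (auto simp: spanning_tree_of_def spanning_def)
  have tails: "tail T = tail G" "head T = head G" and "arcs T \<subseteq> arcs G"
    using sub by (auto simp: subgraph_def compatible_def)
  have arc: "h (tail G e) mod int t = h (head G e) mod int t" if "e \<in> arcs T" for e
  proof (cases "e \<in> Eo")
    case True
    with that h show ?thesis
      by simp
  next
    case False
    have "e \<in> arcs G"
      using that \<open>arcs T \<subseteq> arcs G\<close> by blast
    with False that h[of "arev e"] T_arev show ?thesis
      by (simp add: arev_in_Eo_iff)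
  qed
  have "(u, v) \<in> rtrancl_on (verts T) ((arcs_ends T)\<^sup>s)"
    using conn uv verts by (simp add: connected_conv)
  then show ?thesis
  proof (induction rule: rtrancl_on_induct)
    case (step y z)
    then have "h y mod int t = h z mod int t"
      using arc by (auto simp: symcl_def arcs_ends_conv tails)
    with step show ?case
      by simp
  qed simp
qed

text \<open>
  Both inequalities come from comparing numbers of chains modulo \<open>t\<close>: away from a root vertex, the
  boundary map is injective on chains supported on the tree because the tree has no cycles, and the
  coboundary map is injective on vertex functions vanishing at the root because the tree is connected.
\<close>
lemma card_tree_edges:
  assumes T: "spanning_tree_of T G arev" and t: "t \<ge> 2"
  shows "card (Eo \<inter> arcs T) = card (verts G) - 1"
proof -
  let ?F = "Eo \<inter> arcs T"
  have "verts G \<noteq> {}"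
    using connected by (simp add: connected_conv)
  then obtain r where r: "r \<in> verts G"
    by blast
  let ?V = "verts G - {r}"
  have fin: "finite ?F" "finite ?V"
    by (simp_all add: finite_Eo)
  have card_V: "card ?V = card (verts G) - 1"
    using r by simp
  have "t ^ card ?F \<le> t ^ card ?V"
  proof -
    \<comment> \<open>Chains indexed by \<open>?V\<close> are here functions on the vertices; the
      value 0 at the root puts the image among them.\<close>
    define \<phi> where "\<phi> c v = (if v \<in> ?V then boundary G Eo c v mod int t else 0)" for c v
    have "inj_on \<phi> (chains t ?F)"
    proof (rule inj_onI)
      fix a b assume ab: "a \<in> chains t ?F" "b \<in> chains t ?F" "\<phi> a = \<phi> b"
      let ?d = "\<lambda>e. a e - b e"
      have V: "int t dvd boundary G Eo ?d v" if "v \<in> ?V" for v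
        using fun_cong[OF ab(3), of v] that by (simp add: \<phi>_def boundary_diff mod_eq_dvd_iff)
      \<comment> \<open>The root was left out of \<phi>, but all boundaries sum to 0, so the one at
        the root is determined by the others.\<close>
      have "boundary G Eo ?d r = - (\<Sum>v\<in>?V. boundary G Eo ?d v)"
        using sum_boundary[of ?d] sum.remove[OF finite_verts r, of "boundary G Eo ?d"] by simp
      also have "int t dvd \<dots>"
        unfolding dvd_minus_iff by (intro dvd_sum V)
      finally have bd: "int t dvd boundary G Eo ?d v" if "v \<in> verts G" for v
        using V that by (cases "v = r") auto
      show "a = b"
      proof (rule chains_eqI[OF ab(1,2)])
        fix e assume "e \<in> ?F"
        have "int t dvd a e - b e"
        proof (rule cycle_on_tree_vanishes[OF T _ bd])
          fix e assume "e \<in> Eo - arcs T"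
          then have "a e = 0" "b e = 0"
            using ab(1,2) unfolding chains_def by blast+
          then show "int t dvd a e - b e"
            by simp
        qed (use \<open>e \<in> ?F\<close> in blast)+
        then show "a e mod int t = b e mod int t"
          by (simp add: mod_eq_dvd_iff)
      qed
    qed
    moreover have "\<phi> ` chains t ?F \<subseteq> chains t ?V"
      using t by (simp add: \<phi>_def chains_def image_subset_iff)
    ultimately have "card (chains t ?F) \<le> card (chains t ?V)"
      by (rule card_inj_on_le) (rule finite_chains[OF t_pos fin(2)])
    then show ?thesis
      by (simp only: card_chains[OF t_pos] fin)
  qed
  moreover have "t ^ card ?V \<le> t ^ card ?F"
  proof -
    define \<psi> where "\<psi> f e = (if e \<in> ?F then (f (tail G e) - f (head G e)) mod int t else 0)" for f :: "'v \<Rightarrow> int" and e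
    have "inj_on \<psi> (chains t ?V)"
    proof (rule inj_onI)
      fix a b assume ab: "a \<in> chains t ?V" "b \<in> chains t ?V" "\<psi> a = \<psi> b"
      show "a = b"
      proof (rule chains_eqI[OF ab(1,2)])
        fix v assume "v \<in> ?V"
        \<comment> \<open>Equal coboundaries make the difference constant modulo t, and at the root
          both functions are 0.\<close>
        have "(a v - b v) mod int t = (a r - b r) mod int t"
        proof (rule spanning_tree_path_congruence[OF T])
          fix e assume "e \<in> ?F"
          then show "(a (tail G e) - b (tail G e)) mod int t = (a (head G e) - b (head G e)) mod int t"
            using fun_cong[OF ab(3), of e] by (simp add: \<psi>_def mod_eq_dvd_iff algebra_simps)
        qed (use r \<open>v \<in> ?V\<close> in auto)
        moreover have "a r = 0" "b r = 0"
          using ab(1,2) by (simp_all add: chains_def)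
        ultimately show "a v mod int t = b v mod int t"
          by (simp add: mod_eq_dvd_iff dvd_eq_mod_eq_0)
      qed
    qed
    moreover have "\<psi> ` chains t ?V \<subseteq> chains t ?F"
      using t by (simp add: \<psi>_def chains_def image_subset_iff)
    ultimately have "card (chains t ?V) \<le> card (chains t ?F)"
      by (rule card_inj_on_le) (rule finite_chains[OF t_pos fin(1)])
    then show ?thesis
      by (simp only: card_chains[OF t_pos] fin)
  qed
  ultimately have "t ^ card ?F = t ^ card ?V"
    by (rule antisym)
  \<comment> \<open>Comparing exponents requires a base greater than 1, which is where
    \<open>t \<ge> 2\<close> enters.\<close>
  with t have "card ?F = card ?V"
    by (simp add: power_inject_exp)
  then show ?thesis
    by (simp only: card_V)
qed

lemma card_edges: "card (edges G arev) = card Eo"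
proof -
  have "edge_of arev ` Eo = edges G arev"
  proof
    show "edges G arev \<subseteq> edge_of arev ` Eo"
    proof
      fix x assume "x \<in> edges G arev"
      then obtain e where e: "e \<in> arcs G" "x = edge_of arev e"
        by (auto simp: edges_def)
      then have "x = edge_of arev (arev e)"
        by (auto simp: edge_of_def)
      with e show "x \<in> edge_of arev ` Eo"
        using arev_in_Eo_iff[OF e(1)] by (cases "e \<in> Eo") auto
    qed
  qed (auto simp: edges_def Eo_arc)
  moreover have "inj_on (edge_of arev) Eo"
  proof (rule inj_onI)
    fix e e' assume e: "e \<in> Eo" "e' \<in> Eo" "edge_of arev e = edge_of arev e'"
    then have "e' = e \<or> e' = arev e"
      by (auto simp: edge_of_def doubleton_eq_iff)
    then show "e = e'"
      using e(1,2) arev_in_Eo_iff[OF Eo_arc[OF e(1)]] by metis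
  qed
  ultimately show ?thesis
    using card_image by metis
qed

lemma card_cotree_edges:
  assumes T: "spanning_tree_of T G arev" and t: "t \<ge> 2" and g: "int g = genus G arev"
  shows "card (Eo - arcs T) = g"
proof -
  \<comment> \<open>A vertex must exist for the natural number \<open>card (verts G) - 1\<close> to
    agree with the integer difference in \<open>genus\<close>.\<close>
  have "verts G \<noteq> {}"
    using connected by (simp add: connected_conv)
  then have "card (verts G) \<ge> 1"
    by (simp add: Suc_le_eq card_gt_0_iff)
  moreover have "card Eo = card (Eo \<inter> arcs T) + card (Eo - arcs T)"
    using card_Int_Diff[OF finite_Eo] by simp
  ultimately show ?thesis
    using g card_tree_edges[OF T t] by (simp add: genus_def card_edges)
qed

text \<open>Both sides of the equation are cycles modulo t, so agreement off the tree already forces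
  agreement on it. This turns prescribing the full class into prescribing a restriction.\<close>

lemma restr_walk_ab_eq_iff:
  assumes T: "spanning_tree_of T G arev" and p: "closed_walk G p" and \<alpha>: "\<alpha> \<in> H1 G t Eo"
  shows "restr Eo (walk_ab t arev Eo p) = \<alpha> \<longleftrightarrow>
    restr (Eo - arcs T) (walk_ab t arev Eo p) = restr (Eo - arcs T) \<alpha>"
proof -
  have "restr Eo (walk_ab t arev Eo p) = walk_ab t arev Eo p"
    using walk_ab_chain[of p] by (auto simp: restr_def chains_def)
  moreover have "walk_ab t arev Eo p = \<alpha>"
    if "restr (Eo - arcs T) (walk_ab t arev Eo p) = restr (Eo - arcs T) \<alpha>"
  proof (rule H1_eqI[OF T walk_ab_in_H1[OF p] \<alpha>])
    show "walk_ab t arev Eo p e = \<alpha> e" if "e \<in> Eo - arcs T" for e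
      using fun_cong[OF \<open>restr (Eo - arcs T) _ = _\<close>, of e] that by (simp add: restr_def)
  qed
  ultimately show ?thesis
    by auto
qed

lemma num_circuits_cotree:
  assumes "spanning_tree_of T G arev" "\<alpha> \<in> H1 G t Eo"
  shows "num_circuits G arev Eo t Eo \<alpha> l = num_circuits G arev Eo t (Eo - arcs T) (restr (Eo - arcs T) \<alpha>) l"
  unfolding num_circuits_def
  using restr_walk_ab_eq_iff[OF assms(1) _ assms(2)]
  by (intro arg_cong[of _ _ card]) (auto simp: circuit_def)

lemma num_closed_walks_cotree:
  assumes "spanning_tree_of T G arev" "\<alpha> \<in> H1 G t Eo"
  shows "num_closed_walks G arev Eo t Eo \<alpha> l = num_closed_walks G arev Eo t (Eo - arcs T) (restr (Eo - arcs T) \<alpha>) l"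
  unfolding num_closed_walks_def
  using restr_walk_ab_eq_iff[OF assms(1) _ assms(2)]
  by (intro arg_cong[of _ _ card]) auto

lemma pairing_restr:
  assumes "\<gamma> \<in> chains_on t Eo F"
  shows "pairing t Eo \<gamma> (restr F \<alpha>) = pairing t Eo \<gamma> \<alpha>"
  using assms unfolding pairing_def
  by (intro arg_cong[of _ _ "\<lambda>x. x mod int t"] sum.cong) (auto simp: chains_on_def restr_def)

lemma sum_orb_pairing_restr:
  assumes "c \<in> orbs t arev Eo H (chains_on t Eo F)"
  shows "(\<Sum>\<gamma>\<in>c. root_of_unity t powi (- pairing t Eo \<gamma> (restr F \<alpha>))) =
    (\<Sum>\<gamma>\<in>c. root_of_unity t powi (- pairing t Eo \<gamma> \<alpha>))"
proof (rule sum.cong[OF refl])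
  fix \<gamma> assume "\<gamma> \<in> c"
  with assms have "\<gamma> \<in> chains_on t Eo F"
    by (auto simp: orbs_def orb_def)
  then show "root_of_unity t powi (- pairing t Eo \<gamma> (restr F \<alpha>)) = root_of_unity t powi (- pairing t Eo \<gamma> \<alpha>)"
    by (simp only: pairing_restr)
qed

end

theorem theorem6p13:
  fixes G :: "('v, 'e) pre_digraph" and arev :: "'e \<Rightarrow> 'e" and Eo :: "'e set"
    and H :: "('v, 'e) graph_aut set" and vs :: "'v list" and es :: "'e list" and t :: nat
  assumes "multigraph G arev" and "orientation G arev Eo"
    and "distinct vs" "set vs = verts G"
    and "distinct es" "set es = arcs G"
    and "t \<ge> 2"
    and "subgroup H (Aut G arev)"
  shows
    "(\<forall>F \<alpha> l rep.
        F \<subseteq> Eo \<and> \<alpha> \<in> chains_on t Eo F \<and> l \<ge> 1 \<and>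
        (\<forall>c \<in> orbs t arev Eo H (chains_on t Eo F). rep c \<in> c) \<longrightarrow>
        of_nat (num_circuits G arev Eo t F \<alpha> l) =
          1 / of_nat t ^ card F *
          (\<Sum>c \<in> orbs t arev Eo H (chains_on t Eo F).
             (\<Sum>\<gamma>' \<in> c. root_of_unity t powi (- pairing t Eo \<gamma>' \<alpha>)) *
             mat_trace (edge_adj_mat G arev Eo es t (rep c) ^\<^sub>m l)) \<and>
        of_nat (num_closed_walks G arev Eo t F \<alpha> l) =
          1 / of_nat t ^ card F *
          (\<Sum>c \<in> orbs t arev Eo H (chains_on t Eo F).
             (\<Sum>\<gamma>' \<in> c. root_of_unity t powi (- pairing t Eo \<gamma>' \<alpha>)) *
             mat_trace (adj_mat G arev Eo vs t (rep c) ^\<^sub>m l))) \<and>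
     (\<forall>g T \<alpha> l rep.
        int g = genus G arev \<and> spanning_tree_of T G arev \<and> \<alpha> \<in> H1 G t Eo \<and> l \<ge> 1 \<and>
        (\<forall>c \<in> orbs t arev Eo H (chains_on t Eo (Eo - arcs T)). rep c \<in> c) \<longrightarrow>
        of_nat (num_circuits G arev Eo t Eo \<alpha> l) =
          1 / of_nat t ^ g *
          (\<Sum>c \<in> orbs t arev Eo H (chains_on t Eo (Eo - arcs T)).
             (\<Sum>\<gamma>' \<in> c. root_of_unity t powi (- pairing t Eo \<gamma>' \<alpha>)) *
             mat_trace (edge_adj_mat G arev Eo es t (rep c) ^\<^sub>m l)) \<and>
        of_nat (num_closed_walks G arev Eo t Eo \<alpha> l) =
          1 / of_nat t ^ g *
          (\<Sum>c \<in> orbs t arev Eo H (chains_on t Eo (Eo - arcs T)).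
             (\<Sum>\<gamma>' \<in> c. root_of_unity t powi (- pairing t Eo \<gamma>' \<alpha>)) *
             mat_trace (adj_mat G arev Eo vs t (rep c) ^\<^sub>m l)))"
proof -
  interpret multigraph G arev
    by fact
  interpret oriented_multigraph G arev Eo t
    by unfold_locales (use assms in simp_all)
  note H = \<open>subgroup H (Aut G arev)\<close>
  show ?thesis
  proof (intro conjI allI impI; elim conjE)
    fix F \<alpha> and l :: nat and rep :: "('e \<Rightarrow> int) set \<Rightarrow> 'e \<Rightarrow> int"
    assume F: "F \<subseteq> Eo" and \<alpha>: "\<alpha> \<in> chains_on t Eo F" and l: "l \<ge> 1"
      and rep: "\<forall>c\<in>orbs t arev Eo H (chains_on t Eo F). rep c \<in> c"
    note \<alpha>' = \<alpha>[unfolded chains_on_eq[OF F]] and rep' = bspec[OF rep]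
    show "of_nat (num_circuits G arev Eo t F \<alpha> l) =
          1 / of_nat t ^ card F *
          (\<Sum>c \<in> orbs t arev Eo H (chains_on t Eo F).
             (\<Sum>\<gamma>' \<in> c. root_of_unity t powi (- pairing t Eo \<gamma>' \<alpha>)) *
             mat_trace (edge_adj_mat G arev Eo es t (rep c) ^\<^sub>m l))"
      by (rule num_circuits_eq[OF H F \<alpha>' rep' assms(5,6) l])
    show "of_nat (num_closed_walks G arev Eo t F \<alpha> l) =
          1 / of_nat t ^ card F *
          (\<Sum>c \<in> orbs t arev Eo H (chains_on t Eo F).
             (\<Sum>\<gamma>' \<in> c. root_of_unity t powi (- pairing t Eo \<gamma>' \<alpha>)) *
             mat_trace (adj_mat G arev Eo vs t (rep c) ^\<^sub>m l))"
      by (rule num_closed_walks_eq[OF H F \<alpha>' rep' assms(3,4) l])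
  next
    fix g :: nat and T \<alpha> and l :: nat and rep :: "('e \<Rightarrow> int) set \<Rightarrow> 'e \<Rightarrow> int"
    assume g: "int g = genus G arev" and T: "spanning_tree_of T G arev" and \<alpha>: "\<alpha> \<in> H1 G t Eo" and l: "l \<ge> 1"
      and rep: "\<forall>c\<in>orbs t arev Eo H (chains_on t Eo (Eo - arcs T)). rep c \<in> c"
    let ?F = "Eo - arcs T"
    have card: "card ?F = g"
      by (rule card_cotree_edges[OF T \<open>t \<ge> 2\<close> g])
    have F: "?F \<subseteq> Eo" and \<alpha>': "restr ?F \<alpha> \<in> chains t ?F"
      using \<alpha> by (auto simp: H1_iff intro: restr_chain)
    note rep' = bspec[OF rep]
    show "of_nat (num_circuits G arev Eo t Eo \<alpha> l) =
          1 / of_nat t ^ g *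
          (\<Sum>c \<in> orbs t arev Eo H (chains_on t Eo ?F).
             (\<Sum>\<gamma>' \<in> c. root_of_unity t powi (- pairing t Eo \<gamma>' \<alpha>)) *
             mat_trace (edge_adj_mat G arev Eo es t (rep c) ^\<^sub>m l))"
      \<comment> \<open>The first formula is used with the complement of the tree and the
        restriction of \<alpha>. The count and the coefficient sums are then rewritten back to
        \<alpha> itself.\<close>
      using num_circuits_eq[where rep = rep, OF H F \<alpha>' rep' assms(5,6) l]
      by (simp add: num_circuits_cotree[OF T \<alpha>] card sum_orb_pairing_restr)
    show "of_nat (num_closed_walks G arev Eo t Eo \<alpha> l) =
          1 / of_nat t ^ g *
          (\<Sum>c \<in> orbs t arev Eo H (chains_on t Eo ?F).
             (\<Sum>\<gamma>' \<in> c. root_of_unity t powi (- pairing t Eo \<gamma>' \<alpha>)) *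
             mat_trace (adj_mat G arev Eo vs t (rep c) ^\<^sub>m l))"
      using num_closed_walks_eq[where rep = rep, OF H F \<alpha>' rep' assms(3,4) l]
      by (simp add: num_closed_walks_cotree[OF T \<alpha>] card sum_orb_pairing_restr)
  qed
qed

end
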